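(* Every tight arrow of $\mathbb D\mathbf{TDX}$, i.e. every functor $F:\mathcal A\to\mathcal B$ between small categories, has a companion $F_\natural:\mathcal A\rightsquigarrow\mathcal B$ and a conjoint $F^\natural:\mathcal B\rightsquigarrow\mathcal A$ in $\mathbb D\mathbf{TDX}$, namely the images of the companion and conjoint of $F$ in the double category of profunctors under the embedding $p\mapsto\bar p$. Explicitly, both have terminal state category $\mathcal I=\{\bullet\}$ and - $F_\natural(a;\bullet,\bullet)[\underline b]=\mathcal B(b,Fa)$ if $\underline b=[b]$ has length one, and $\varnothing$ otherwise; - $F^\natural(b;\bullet,\bullet)[\underline a]=\mathcal B(Fa,b)$ if $\underline a=[a]$ has length one, and $\varnothing$ otherwise.
   Context: All categories are small. $\mathcal B^*$ is the free monoidal category on $\mathcal B$: objects are finite lists, morphisms between lists of the same length are tuples of morphisms (none between different lengths), tensor is concatenation, unit $[\,]$; $[b]$ is the one-letter list; a functor $G$ induces $G^*$ on lists. $\mathcal K\langle\mathcal B\rangle=[(\mathcal B^* )^{op},\mathrm{Set}]$ with Day convolution $\otimes$. In the double category $\mathbb D\mathbf{TDX}$ objects are small categories, tight arrows are functors, and loose arrows are 2-transducers $(\mathcal Q,t):\mathcal A\rightsquigarrow\mathcal B$, i.e. a category $\mathcal Q$ with a functor $t:\mathcal A\times\mathcal Q^{op}\times\mathcal Q\to\mathcal K\langle\mathcal B\rangle$, values $t(a;q,q')[\underline b]$, extended to lists by $t([\,];q,q')=\mathcal Q(q,q')\cdot\mathcal B^*(-,[\,])$ and $t((a_1,\dots,a_n);q,q')=\int^{x_1,\dots,x_{n-1}}t(a_1;q,x_1)\otimes\cdots\otimes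 t(a_n;x_{n-1},q')$. A cell from $(\mathcal Q,s):\mathcal A\rightsquigarrow\mathcal B$ to $(\mathcal P,t):\mathcal A'\rightsquigarrow\mathcal B'$ over functors $F:\mathcal A\to\mathcal A'$, $G:\mathcal B\to\mathcal B'$ is a pair $(U,\alpha)$ with $U:\mathcal Q\to\mathcal P$ a functor and $\alpha:s(a;q,q')[\underline b]\to t(Fa;Uq,Uq')[G^*\underline b]$ natural (extended letterwise to lists in the first variable). Loose composition of $(\mathcal Q,s):\mathcal A\rightsquigarrow\mathcal B$ and $(\mathcal P,t):\mathcal B\rightsquigarrow\mathcal C$ has state category $\mathcal Q\times\mathcal P$ and $(t\circ s)(a;(q,p),(q',p'))[\underline c]=\int^{\underline b\in\mathcal B^*}s(a;q,q')[\underline b]\times t(\underline b;p,p')[\underline c]$; loose identities are $(\mathcal I,\iota)$ with $\iota(a;\bullet,\bullet)=\mathcal A^*(-,[a])$; cells compose vertically by composition and horizontally by the product of state functors and the induced maps on coends. The embedding $p\mapsto\bar p$ sends a profunctor $p:\mathcal A\times\mathcal B^{op}\to\mathrm{Set}$ to the 2-transducer with state category $\mathcal I$, equal to $p(a,b)$ on $[b]$ and empty on lists of other lengths. A companion of $F:\mathcal A\to\mathcal B$ is a loose arrow $F_\natural:\mathcal A\rightsquigarrow\mathcal B$ with cells $\iota_{\mathcal A}\to F_\natural$ over $(\mathrm{id}_{\mathcal A},F)$ and $F_\natural\to\iota_{\mathcal B}$ over $(F,\mathrm{id}_{\mathcal B})$ whose vertical composite is the identity cell on $F$ and whose horizontal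 composite is the identity of $F_\natural$ (up to unitors). A conjoint is a loose arrow $F^\natural:\mathcal B\rightsquigarrow\mathcal A$ with cells $F^\natural\to\iota_{\mathcal B}$ over $(\mathrm{id}_{\mathcal B},F)$ and $\iota_{\mathcal A}\to F^\natural$ over $(F,\mathrm{id}_{\mathcal A})$ satisfying the two dual equations. *)

theory Defs
  imports Main
begin

section \<open>Small categories and functors\<close>

text \<open>\<open>Cmp C g f\<close> is the composite of \<open>f\<close> followed by \<open>g\<close>. Only the behaviour on the
  carriers \<open>Ob\<close>, \<open>Arr\<close> matters; the operations are arbitrary elsewhere.\<close>

record ('o, 'm) cat =
  Ob :: "'o set"
  Arr :: "'m set"
  Dom :: "'m \<Rightarrow> 'o"
  Cod :: "'m \<Rightarrow> 'o"
  Idt :: "'o \<Rightarrow> 'm"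
  Cmp :: "'m \<Rightarrow> 'm \<Rightarrow> 'm"

definition Hom :: "('o, 'm) cat \<Rightarrow> 'o \<Rightarrow> 'o \<Rightarrow> 'm set" where
  "Hom C x y = {f \<in> Arr C. Dom C f = x \<and> Cod C f = y}"

definition small_category :: "('o, 'm) cat \<Rightarrow> bool" where
  "small_category C \<longleftrightarrow>
     (\<forall>f\<in>Arr C. Dom C f \<in> Ob C \<and> Cod C f \<in> Ob C) \<and>
     (\<forall>x\<in>Ob C. Idt C x \<in> Hom C x x) \<and>
     (\<forall>f\<in>Arr C. \<forall>g\<in>Arr C. Cod C f = Dom C g \<longrightarrow> Cmp C g f \<in> Hom C (Dom C f) (Cod C g)) \<and>
     (\<forall>f\<in>Arr C. Cmp C f (Idt C (Dom C f)) = f \<and> Cmp C (Idt C (Cod C f)) f = f) \<and>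
     (\<forall>f\<in>Arr C. \<forall>g\<in>Arr C. \<forall>h\<in>Arr C. Cod C f = Dom C g \<longrightarrow> Cod C g = Dom C h \<longrightarrow>
        Cmp C h (Cmp C g f) = Cmp C (Cmp C h g) f)"

record ('o, 'm, 'p, 'n) func =
  Fob :: "'o \<Rightarrow> 'p"
  Far :: "'m \<Rightarrow> 'n"

definition is_functor ::
    "('o, 'm) cat \<Rightarrow> ('p, 'n) cat \<Rightarrow> ('o, 'm, 'p, 'n) func \<Rightarrow> bool" where
  "is_functor C D F \<longleftrightarrow>
     (\<forall>x\<in>Ob C. Fob F x \<in> Ob D) \<and>
     (\<forall>f\<in>Arr C. Far F f \<in> Hom D (Fob F (Dom C f)) (Fob F (Cod C f))) \<and>
     (\<forall>x\<in>Ob C. Far F (Idt C x) = Idt D (Fob F x)) \<and>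
     (\<forall>f\<in>Arr C. \<forall>g\<in>Arr C. Cod C f = Dom C g \<longrightarrow> Far F (Cmp C g f) = Cmp D (Far F g) (Far F f))"

definition functor_eq ::
    "('o, 'm) cat \<Rightarrow> ('o, 'm, 'p, 'n) func \<Rightarrow> ('o, 'm, 'p, 'n) func \<Rightarrow> bool" where
  "functor_eq C F G \<longleftrightarrow> (\<forall>x\<in>Ob C. Fob F x = Fob G x) \<and> (\<forall>f\<in>Arr C. Far F f = Far G f)"

definition id_func :: "('o, 'm) cat \<Rightarrow> ('o, 'm, 'o, 'm) func" where
  "id_func C = \<lparr>Fob = (\<lambda>x. x), Far = (\<lambda>f. f)\<rparr>"

definition comp_func ::
    "('p, 'n, 'r, 'k) func \<Rightarrow> ('o, 'm, 'p, 'n) func \<Rightarrow> ('o, 'm, 'r, 'k) func" where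
  "comp_func G F = \<lparr>Fob = (\<lambda>x. Fob G (Fob F x)), Far = (\<lambda>f. Far G (Far F f))\<rparr>"

definition op_cat :: "('o, 'm) cat \<Rightarrow> ('o, 'm) cat" where
  "op_cat C = \<lparr>Ob = Ob C, Arr = Arr C, Dom = Cod C, Cod = Dom C, Idt = Idt C,
     Cmp = (\<lambda>g f. Cmp C f g)\<rparr>"

definition prod_cat ::
    "('o, 'm) cat \<Rightarrow> ('p, 'n) cat \<Rightarrow> ('o \<times> 'p, 'm \<times> 'n) cat" (infixr "\<times>\<^sub>C" 80) where
  "C \<times>\<^sub>C D = \<lparr>Ob = Ob C \<times> Ob D, Arr = Arr C \<times> Arr D,
     Dom = (\<lambda>(f, g). (Dom C f, Dom D g)), Cod = (\<lambda>(f, g). (Cod C f, Cod D g)),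
     Idt = (\<lambda>(x, y). (Idt C x, Idt D y)),
     Cmp = (\<lambda>(f', g') (f, g). (Cmp C f' f, Cmp D g' g))\<rparr>"

definition prod_func ::
    "('o, 'm, 'p, 'n) func \<Rightarrow> ('r, 'k, 's, 'l) func
      \<Rightarrow> ('o \<times> 'r, 'm \<times> 'k, 'p \<times> 's, 'n \<times> 'l) func" (infixr "\<times>\<^sub>f" 80) where
  "F \<times>\<^sub>f G = \<lparr>Fob = map_prod (Fob F) (Fob G), Far = map_prod (Far F) (Far G)\<rparr>"

definition unit_cat :: "(unit, unit) cat" where
  "unit_cat = \<lparr>Ob = {()}, Arr = {()}, Dom = (\<lambda>_. ()), Cod = (\<lambda>_. ()), Idt = (\<lambda>_. ()),
     Cmp = (\<lambda>_ _. ())\<rparr>"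

text \<open>The free monoidal category. An arrow is the list of its components, so its domain and
  codomain have the same length. The tensor is \<open>@\<close> (n-ary: \<open>concat\<close>), on objects and on arrows.\<close>

definition star :: "('o, 'm) cat \<Rightarrow> ('o list, 'm list) cat" where
  "star C = \<lparr>Ob = lists (Ob C), Arr = lists (Arr C), Dom = map (Dom C), Cod = map (Cod C),
     Idt = map (Idt C), Cmp = map2 (Cmp C)\<rparr>"

definition star_func :: "('o, 'm, 'p, 'n) func \<Rightarrow> ('o list, 'm list, 'p list, 'n list) func" where
  "star_func F = \<lparr>Fob = map (Fob F), Far = map (Far F)\<rparr>"

text \<open>The power \<open>C\<^sup>n\<close>, with lists of length \<open>n\<close> as tuples.\<close>

definition pow_cat :: "('o, 'm) cat \<Rightarrow> nat \<Rightarrow> ('o list, 'm list) cat" where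
  "pow_cat C n = (star C)\<lparr>Ob := {xs \<in> lists (Ob C). length xs = n},
     Arr := {fs \<in> lists (Arr C). length fs = n}\<rparr>"


section \<open>Set-valued functors and coends\<close>

record ('o, 'm, 'e) sfun =
  Val :: "'o \<Rightarrow> 'e set"
  Act :: "'m \<Rightarrow> 'e \<Rightarrow> 'e"

definition is_sfun :: "('o, 'm) cat \<Rightarrow> ('o, 'm, 'e) sfun \<Rightarrow> bool" where
  "is_sfun C X \<longleftrightarrow>
     (\<forall>f\<in>Arr C. \<forall>e\<in>Val X (Dom C f). Act X f e \<in> Val X (Cod C f)) \<and>
     (\<forall>x\<in>Ob C. \<forall>e\<in>Val X x. Act X (Idt C x) e = e) \<and>
     (\<forall>f\<in>Arr C. \<forall>g\<in>Arr C. Cod C f = Dom C g \<longrightarrow>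
        (\<forall>e\<in>Val X (Dom C f). Act X (Cmp C g f) e = Act X g (Act X f e)))"

definition pullback_sfun ::
    "('o, 'm, 'p, 'n) func \<Rightarrow> ('p, 'n, 'e) sfun \<Rightarrow> ('o, 'm, 'e) sfun" where
  "pullback_sfun F X = \<lparr>Val = (\<lambda>x. Val X (Fob F x)), Act = (\<lambda>f. Act X (Far F f))\<rparr>"

definition is_natural ::
    "('o, 'm) cat \<Rightarrow> ('o, 'm, 'e) sfun \<Rightarrow> ('o, 'm, 'd) sfun \<Rightarrow> ('o \<Rightarrow> 'e \<Rightarrow> 'd) \<Rightarrow> bool" where
  "is_natural C X Y \<alpha> \<longleftrightarrow>
     (\<forall>x\<in>Ob C. \<forall>e\<in>Val X x. \<alpha> x e \<in> Val Y x) \<and>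
     (\<forall>f\<in>Arr C. \<forall>e\<in>Val X (Dom C f). \<alpha> (Cod C f) (Act X f e) = Act Y f (\<alpha> (Dom C f) e))"

text \<open>The coend of \<open>P : C\<^sup>o\<^sup>p \<times> C \<rightarrow> Set\<close> is the quotient of the disjoint union of the \<open>P (c, c)\<close>
  by the equivalence relation generated by \<open>P (f, 1) y \<sim> P (1, f) y\<close>; its elements are
  equivalence classes.\<close>

definition coend_carrier ::
    "('o, 'm) cat \<Rightarrow> ('o \<times> 'o, 'm \<times> 'm, 'e) sfun \<Rightarrow> ('o \<times> 'e) set" where
  "coend_carrier C P = {(c, x). c \<in> Ob C \<and> x \<in> Val P (c, c)}"

definition coend_step ::
    "('o, 'm) cat \<Rightarrow> ('o \<times> 'o, 'm \<times> 'm, 'e) sfun \<Rightarrow> (('o \<times> 'e) \<times> ('o \<times> 'e)) set" where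
  "coend_step C P =
     {((Dom C f, Act P (f, Idt C (Dom C f)) y), (Cod C f, Act P (Idt C (Cod C f), f) y)) | f y.
        f \<in> Arr C \<and> y \<in> Val P (Cod C f, Dom C f)}"

definition coend_rel ::
    "('o, 'm) cat \<Rightarrow> ('o \<times> 'o, 'm \<times> 'm, 'e) sfun \<Rightarrow> (('o \<times> 'e) \<times> ('o \<times> 'e)) set" where
  "coend_rel C P = (coend_step C P \<union> (coend_step C P)\<inverse>)\<^sup>*
     \<inter> (coend_carrier C P \<times> coend_carrier C P)"

definition coend ::
    "('o, 'm) cat \<Rightarrow> ('o \<times> 'o, 'm \<times> 'm, 'e) sfun \<Rightarrow> ('o \<times> 'e) set set" where
  "coend C P = coend_carrier C P // coend_rel C P"

text \<open>The map into \<open>coend D P'\<close> induced by a map \<open>\<phi>\<close> of representatives, and the map into a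
  set induced by a map that is constant on classes.\<close>

definition coend_map ::
    "('p, 'n) cat \<Rightarrow> ('p \<times> 'p, 'n \<times> 'n, 'd) sfun \<Rightarrow> ('o \<times> 'e \<Rightarrow> 'p \<times> 'd)
      \<Rightarrow> ('o \<times> 'e) set \<Rightarrow> ('p \<times> 'd) set" where
  "coend_map D P' \<phi> X = coend_rel D P' `` (\<phi> ` X)"

definition coend_desc :: "('o \<times> 'e \<Rightarrow> 'd) \<Rightarrow> ('o \<times> 'e) set \<Rightarrow> 'd" where
  "coend_desc \<phi> X = the_elem (\<phi> ` X)"


section \<open>Day convolution\<close>

text \<open>An element of \<open>\<K>\<langle>B\<rangle>\<close> is a set-valued functor on \<open>op_cat (star B)\<close>. The n-ary Day
  convolution of \<open>X\<^sub>1, \<dots>, X\<^sub>n\<close> at \<open>c\<close> is the coend over \<open>c\<^sub>1, \<dots>, c\<^sub>n\<close> of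
  \<open>X\<^sub>1[c\<^sub>1] \<times> \<dots> \<times> X\<^sub>n[c\<^sub>n] \<times> B\<^sup>*(c, c\<^sub>1 @ \<dots> @ c\<^sub>n)\<close>.\<close>

definition day_integrand ::
    "('b, 'g) cat \<Rightarrow> ('b list, 'g list, 'e) sfun list \<Rightarrow> 'b list
      \<Rightarrow> ('b list list \<times> 'b list list, 'g list list \<times> 'g list list, 'e list \<times> 'g list) sfun" where
  "day_integrand B Xs c =
     \<lparr>Val = (\<lambda>(cs, cs'). listset (map2 Val Xs cs) \<times> Hom (star B) c (concat cs')),
      Act = (\<lambda>(\<gamma>, \<gamma>') (es, k).
        (map2 (\<lambda>X (g, e). Act X g e) Xs (zip \<gamma> es), Cmp (star B) (concat \<gamma>') k))\<rparr>"

definition day ::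
    "('b, 'g) cat \<Rightarrow> ('b list, 'g list, 'e) sfun list
      \<Rightarrow> ('b list, 'g list, ('b list list \<times> ('e list \<times> 'g list)) set) sfun" where
  "day B Xs =
     \<lparr>Val = (\<lambda>c. coend (pow_cat (star B) (length Xs)) (day_integrand B Xs c)),
      Act = (\<lambda>\<beta>. coend_map (pow_cat (star B) (length Xs)) (day_integrand B Xs (Dom (star B) \<beta>))
        (\<lambda>(cs, (es, k)). (cs, (es, Cmp (star B) k \<beta>))))\<rparr>"

text \<open>The component at \<open>c\<close> of the Day convolution of transformations \<open>\<theta>\<^sub>i : X\<^sub>i \<rightarrow> Y\<^sub>i\<close>.\<close>

definition day_map ::
    "('b, 'g) cat \<Rightarrow> ('b list, 'g list, 'd) sfun list \<Rightarrow> 'b list \<Rightarrow> ('b list \<Rightarrow> 'e \<Rightarrow> 'd) list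
      \<Rightarrow> ('b list list \<times> ('e list \<times> 'g list)) set \<Rightarrow> ('b list list \<times> ('d list \<times> 'g list)) set" where
  "day_map B Ys c \<theta>s = coend_map (pow_cat (star B) (length Ys)) (day_integrand B Ys c)
     (\<lambda>(cs, (es, k)). (cs, (map2 (\<lambda>\<theta> (d, e). \<theta> d e) \<theta>s (zip cs es), k)))"


section \<open>2-transducers\<close>

text \<open>The functor \<open>A \<times> Q\<^sup>o\<^sup>p \<times> Q \<rightarrow> [(B\<^sup>*)\<^sup>o\<^sup>p, Set]\<close> is stored uncurried, as a functor
  \<open>A \<times> Q\<^sup>o\<^sup>p \<times> Q \<times> (B\<^sup>*)\<^sup>o\<^sup>p \<rightarrow> Set\<close>.\<close>

record ('a, 'f, 'b, 'g, 'q, 'h, 'e) transducer =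
  St :: "('q, 'h) cat"
  Tr :: "('a \<times> 'q \<times> 'q \<times> 'b list, 'f \<times> 'h \<times> 'h \<times> 'g list, 'e) sfun"

definition td_index ::
    "('a, 'f) cat \<Rightarrow> ('q, 'h) cat \<Rightarrow> ('b, 'g) cat
      \<Rightarrow> ('a \<times> 'q \<times> 'q \<times> 'b list, 'f \<times> 'h \<times> 'h \<times> 'g list) cat" where
  "td_index A Q B = A \<times>\<^sub>C op_cat Q \<times>\<^sub>C Q \<times>\<^sub>C op_cat (star B)"

definition is_transducer ::
    "('a, 'f) cat \<Rightarrow> ('b, 'g) cat \<Rightarrow> ('a, 'f, 'b, 'g, 'q, 'h, 'e) transducer \<Rightarrow> bool" where
  "is_transducer A B T \<longleftrightarrow> small_category (St T) \<and> is_sfun (td_index A (St T) B) (Tr T)"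

text \<open>The presheaves \<open>t(a\<^sub>i; q\<^sub>i, q'\<^sub>i)\<close>, and the transformations between them induced by arrows.\<close>

definition word_ps ::
    "('a, 'f) cat \<Rightarrow> ('a, 'f, 'b, 'g, 'q, 'h, 'e) transducer \<Rightarrow> 'a list \<Rightarrow> 'q list \<Rightarrow> 'q list
      \<Rightarrow> ('b list, 'g list, 'e) sfun list" where
  "word_ps A T as qs qs' = map2 (\<lambda>a (q, q').
     \<lparr>Val = (\<lambda>c. Val (Tr T) (a, q, q', c)),
      Act = (\<lambda>\<beta>. Act (Tr T) (Idt A a, Idt (St T) q, Idt (St T) q', \<beta>))\<rparr>) as (zip qs qs')"

definition word_trans ::
    "('b, 'g) cat \<Rightarrow> ('a, 'f, 'b, 'g, 'q, 'h, 'e) transducer \<Rightarrow> 'f list \<Rightarrow> 'h list \<Rightarrow> 'h list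
      \<Rightarrow> ('b list \<Rightarrow> 'e \<Rightarrow> 'e) list" where
  "word_trans B T fs us us' = map2 (\<lambda>f (u, u').
     (\<lambda>d. Act (Tr T) (f, u, u', Idt (star B) d))) fs (zip us us')"

text \<open>\<open>t(a\<^sub>1; q, x\<^sub>1) \<otimes> \<dots> \<otimes> t(a\<^sub>n; x'\<^sub>n\<^sub>-\<^sub>1, q')\<close> at \<open>c\<close>, as a functor of \<open>(xs', xs)\<close>:
  \<open>t\<close> is contravariant in its first state, so the source states are the contravariant ones.\<close>

definition word_integrand ::
    "('a, 'f) cat \<Rightarrow> ('b, 'g) cat \<Rightarrow> ('a, 'f, 'b, 'g, 'q, 'h, 'e) transducer
      \<Rightarrow> 'a list \<Rightarrow> 'q \<Rightarrow> 'q \<Rightarrow> 'b list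
      \<Rightarrow> ('q list \<times> 'q list, 'h list \<times> 'h list,
          ('b list list \<times> ('e list \<times> 'g list)) set) sfun" where
  "word_integrand A B T as q q' c =
     \<lparr>Val = (\<lambda>(xs, xs'). Val (day B (word_ps A T as (q # xs) (xs' @ [q']))) c),
      Act = (\<lambda>(us, us').
        day_map B (word_ps A T as (q # map (Dom (St T)) us) (map (Cod (St T)) us' @ [q'])) c
          (word_trans B T (map (Idt A) as) (Idt (St T) q # us) (us' @ [Idt (St T) q'])))\<rparr>"

text \<open>Elements of the extension \<open>t(\<a>; q, q')[c]\<close> to lists \<open>\<a>\<close> of length 0, 1 and at least 2.\<close>

datatype ('b, 'g, 'q, 'h, 'e) word_elt =
    Empty_word 'h "'g list"
  | Letter 'e
  | Word "('q list \<times> ('b list list \<times> ('e list \<times> 'g list)) set) set"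

definition ext ::
    "('a, 'f) cat \<Rightarrow> ('b, 'g) cat \<Rightarrow> ('a, 'f, 'b, 'g, 'q, 'h, 'e) transducer
      \<Rightarrow> ('a list \<times> 'q \<times> 'q \<times> 'b list, 'f list \<times> 'h \<times> 'h \<times> 'g list,
          ('b, 'g, 'q, 'h, 'e) word_elt) sfun" where
  "ext A B T =
     \<lparr>Val = (\<lambda>(as, q, q', c). case as of
          [] \<Rightarrow> {Empty_word u k | u k. u \<in> Hom (St T) q q' \<and> k \<in> Hom (star B) c []}
        | [a] \<Rightarrow> Letter ` Val (Tr T) (a, q, q', c)
        | _ \<Rightarrow> Word ` coend (pow_cat (St T) (length as - 1)) (word_integrand A B T as q q' c)),
      Act = (\<lambda>(fs, g, h, \<beta>) e. case e of
          Empty_word u k \<Rightarrow> Empty_word (Cmp (St T) h (Cmp (St T) u g)) (Cmp (star B) k \<beta>)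
        | Letter x \<Rightarrow> Letter (Act (Tr T) (hd fs, g, h, \<beta>) x)
        | Word X \<Rightarrow> Word (coend_map (pow_cat (St T) (length fs - 1))
            (word_integrand A B T (map (Cod A) fs) (Dom (St T) g) (Cod (St T) h) (Dom (star B) \<beta>))
            (\<lambda>(xs, D).
              let ids = map (Idt (St T)) xs;
                  Ys = word_ps A T (map (Cod A) fs) (Dom (St T) g # xs) (xs @ [Cod (St T) h])
              in (xs, Act (day B Ys) \<beta>
                   (day_map B Ys (Cod (star B) \<beta>) (word_trans B T fs (g # ids) (ids @ [h])) D))) X))\<rparr>"


section \<open>Loose composition and loose identities\<close>

definition comp_integrand ::
    "('a, 'f) cat \<Rightarrow> ('b, 'g) cat \<Rightarrow> ('c, 'k) cat
      \<Rightarrow> ('a, 'f, 'b, 'g, 'q, 'h, 'e) transducer \<Rightarrow> ('b, 'g, 'c, 'k, 'p, 'l, 'd) transducer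
      \<Rightarrow> 'a \<Rightarrow> 'q \<times> 'p \<Rightarrow> 'q \<times> 'p \<Rightarrow> 'c list
      \<Rightarrow> ('b list \<times> 'b list, 'g list \<times> 'g list,
          'e \<times> ('c, 'k, 'p, 'l, 'd) word_elt) sfun" where
  "comp_integrand A B C S T a = (\<lambda>(q, p) (q', p') c.
     \<lparr>Val = (\<lambda>(bs, bs'). Val (Tr S) (a, q, q', bs) \<times> Val (ext B C T) (bs', p, p', c)),
      Act = (\<lambda>(\<gamma>, \<gamma>'). map_prod
        (Act (Tr S) (Idt A a, Idt (St S) q, Idt (St S) q', \<gamma>))
        (Act (ext B C T) (\<gamma>', Idt (St T) p, Idt (St T) p', Idt (star C) c)))\<rparr>)"

text \<open>\<open>loose_comp A B C S T\<close> is the composite of \<open>S : A \<leadsto> B\<close> followed by \<open>T : B \<leadsto> C\<close>.\<close>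

definition loose_comp ::
    "('a, 'f) cat \<Rightarrow> ('b, 'g) cat \<Rightarrow> ('c, 'k) cat
      \<Rightarrow> ('a, 'f, 'b, 'g, 'q, 'h, 'e) transducer \<Rightarrow> ('b, 'g, 'c, 'k, 'p, 'l, 'd) transducer
      \<Rightarrow> ('a, 'f, 'c, 'k, 'q \<times> 'p, 'h \<times> 'l,
          ('b list \<times> ('e \<times> ('c, 'k, 'p, 'l, 'd) word_elt)) set) transducer" where
  "loose_comp A B C S T =
     \<lparr>St = St S \<times>\<^sub>C St T,
      Tr = \<lparr>Val = (\<lambda>(a, qp, qp', c). coend (star B) (comp_integrand A B C S T a qp qp' c)),
            Act = (\<lambda>(f, (g, l), (g', l'), \<beta>). coend_map (star B)
              (comp_integrand A B C S T (Cod A f) (Dom (St S) g, Dom (St T) l)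
                 (Cod (St S) g', Cod (St T) l') (Dom (star C) \<beta>))
              (\<lambda>(bs, (x, y)). (bs, (Act (Tr S) (f, g, g', Idt (star B) bs) x,
                                     Act (ext B C T) (Idt (star B) bs, l, l', \<beta>) y))))\<rparr>\<rparr>"

definition loose_id :: "('a, 'f) cat \<Rightarrow> ('a, 'f, 'a, 'f, unit, unit, 'f list) transducer" where
  "loose_id A =
     \<lparr>St = unit_cat,
      Tr = \<lparr>Val = (\<lambda>(a, _, _, as). Hom (star A) as [a]),
            Act = (\<lambda>(f, _, _, \<beta>) k. Cmp (star A) [f] (Cmp (star A) k \<beta>))\<rparr>\<rparr>"


section \<open>Cells\<close>

text \<open>A cell is given by its state functor and its family of maps; the boundary is a parameter of
  the predicate \<open>is_cell\<close>: here \<open>S : A \<leadsto> B\<close> is the source, \<open>T : A' \<leadsto> B'\<close> the target, and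
  \<open>F : A \<rightarrow> A'\<close>, \<open>G : B \<rightarrow> B'\<close>.\<close>

record ('a, 'b, 'q, 'h, 'p, 'l, 'e, 'd) cell =
  CSt :: "('q, 'h, 'p, 'l) func"
  CMap :: "'a \<times> 'q \<times> 'q \<times> 'b list \<Rightarrow> 'e \<Rightarrow> 'd"

definition is_cell ::
    "('a, 'f) cat \<Rightarrow> ('b, 'g) cat \<Rightarrow> ('a', 'f') cat \<Rightarrow> ('b', 'g') cat
      \<Rightarrow> ('a, 'f, 'a', 'f') func \<Rightarrow> ('b, 'g, 'b', 'g') func
      \<Rightarrow> ('a, 'f, 'b, 'g, 'q, 'h, 'e) transducer \<Rightarrow> ('a', 'f', 'b', 'g', 'p, 'l, 'd) transducer
      \<Rightarrow> ('a, 'b, 'q, 'h, 'p, 'l, 'e, 'd) cell \<Rightarrow> bool" where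
  "is_cell A B A' B' F G S T \<sigma> \<longleftrightarrow>
     is_functor A A' F \<and> is_functor B B' G \<and> is_functor (St S) (St T) (CSt \<sigma>) \<and>
     is_natural (td_index A (St S) B) (Tr S)
       (pullback_sfun (F \<times>\<^sub>f CSt \<sigma> \<times>\<^sub>f CSt \<sigma> \<times>\<^sub>f star_func G) (Tr T)) (CMap \<sigma>)"

definition cell_eq ::
    "('a, 'f) cat \<Rightarrow> ('b, 'g) cat \<Rightarrow> ('a, 'f, 'b, 'g, 'q, 'h, 'e) transducer
      \<Rightarrow> ('a, 'b, 'q, 'h, 'p, 'l, 'e, 'd) cell \<Rightarrow> ('a, 'b, 'q, 'h, 'p, 'l, 'e, 'd) cell \<Rightarrow> bool" where
  "cell_eq A B S \<sigma> \<tau> \<longleftrightarrow> functor_eq (St S) (CSt \<sigma>) (CSt \<tau>) \<and>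
     (\<forall>i\<in>Ob (td_index A (St S) B). \<forall>e\<in>Val (Tr S) i. CMap \<sigma> i e = CMap \<tau> i e)"

text \<open>The identity cell of a loose arrow (over identity functors), and the identity cell
  \<open>\<iota>\<^sub>A \<rightarrow> \<iota>\<^sub>B\<close> over \<open>(F, F)\<close> of a tight arrow \<open>F\<close>.\<close>

definition id_cell ::
    "('a, 'f, 'b, 'g, 'q, 'h, 'e) transducer \<Rightarrow> ('a, 'b, 'q, 'h, 'q, 'h, 'e, 'e) cell" where
  "id_cell T = \<lparr>CSt = id_func (St T), CMap = (\<lambda>_ e. e)\<rparr>"

definition tight_id_cell ::
    "('a, 'f, 'b, 'g) func \<Rightarrow> ('a, 'a, unit, unit, unit, unit, 'f list, 'g list) cell" where
  "tight_id_cell F = \<lparr>CSt = id_func unit_cat, CMap = (\<lambda>_. Far (star_func F))\<rparr>"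

text \<open>\<open>vcomp F G \<sigma> \<tau>\<close> is \<open>\<sigma>\<close> followed by \<open>\<tau>\<close>, where \<open>\<sigma>\<close> lies over \<open>(F, G)\<close>.\<close>

definition vcomp ::
    "('a, 'f, 'a', 'f') func \<Rightarrow> ('b, 'g, 'b', 'g') func
      \<Rightarrow> ('a, 'b, 'q, 'h, 'p, 'l, 'e, 'd) cell \<Rightarrow> ('a', 'b', 'p, 'l, 'r, 'k, 'd, 'c) cell
      \<Rightarrow> ('a, 'b, 'q, 'h, 'r, 'k, 'e, 'c) cell" where
  "vcomp F G \<sigma> \<tau> =
     \<lparr>CSt = comp_func (CSt \<tau>) (CSt \<sigma>),
      CMap = (\<lambda>i e. CMap \<tau> (Fob (F \<times>\<^sub>f CSt \<sigma> \<times>\<^sub>f CSt \<sigma> \<times>\<^sub>f star_func G) i) (CMap \<sigma> i e))\<rparr>"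

text \<open>The letterwise extension to lists of a cell \<open>\<tau>\<close> over \<open>(G, H)\<close> with target
  \<open>T' : B' \<leadsto> C'\<close>.\<close>

definition ext_cell ::
    "('b', 'g') cat \<Rightarrow> ('c', 'k') cat \<Rightarrow> ('b, 'g, 'b', 'g') func \<Rightarrow> ('c, 'k, 'c', 'k') func
      \<Rightarrow> ('b', 'g', 'c', 'k', 'p', 'l', 'd') transducer
      \<Rightarrow> ('b, 'c, 'p, 'l, 'p', 'l', 'd, 'd') cell
      \<Rightarrow> 'b list \<times> 'p \<times> 'p \<times> 'c list
      \<Rightarrow> ('c, 'k, 'p, 'l, 'd) word_elt \<Rightarrow> ('c', 'k', 'p', 'l', 'd') word_elt" where
  "ext_cell B' C' G H T' \<tau> = (\<lambda>(bs, p, p', c) e. let V = Fob (CSt \<tau>) in case e of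
       Empty_word u k \<Rightarrow> Empty_word (Far (CSt \<tau>) u) (Far (star_func H) k)
     | Letter x \<Rightarrow> Letter (CMap \<tau> (hd bs, p, p', c) x)
     | Word X \<Rightarrow> Word (coend_map (pow_cat (St T') (length bs - 1))
         (word_integrand B' C' T' (map (Fob G) bs) (V p) (V p') (map (Fob H) c))
         (\<lambda>(xs, D). (map V xs,
            coend_map (pow_cat (star C') (length bs))
              (day_integrand C'
                 (word_ps B' T' (map (Fob G) bs) (V p # map V xs) (map V xs @ [V p']))
                 (map (Fob H) c))
              (\<lambda>(ds, (es, k)). (map (map (Fob H)) ds,
                 (map2 (\<lambda>(b, d) (r, r', x). CMap \<tau> (b, r, r', d) x)
                    (zip bs ds) (zip (p # xs) (zip (xs @ [p']) es)),
                  Far (star_func H) k))) D)) X))"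

text \<open>The horizontal composite of \<open>\<sigma> : S \<rightarrow> S'\<close> over \<open>(F, G)\<close> and \<open>\<tau> : T \<rightarrow> T'\<close> over \<open>(G, H)\<close>,
  with \<open>S' : A' \<leadsto> B'\<close> and \<open>T' : B' \<leadsto> C'\<close>.\<close>

definition hcomp ::
    "('a', 'f') cat \<Rightarrow> ('b', 'g') cat \<Rightarrow> ('c', 'k') cat
      \<Rightarrow> ('a, 'f, 'a', 'f') func \<Rightarrow> ('b, 'g, 'b', 'g') func \<Rightarrow> ('c, 'k, 'c', 'k') func
      \<Rightarrow> ('a', 'f', 'b', 'g', 'q', 'h', 'e') transducer
      \<Rightarrow> ('b', 'g', 'c', 'k', 'p', 'l', 'd') transducer
      \<Rightarrow> ('a, 'b, 'q, 'h, 'q', 'h', 'e, 'e') cell \<Rightarrow> ('b, 'c, 'p, 'l, 'p', 'l', 'd, 'd') cell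
      \<Rightarrow> ('a, 'c, 'q \<times> 'p, 'h \<times> 'l, 'q' \<times> 'p', 'h' \<times> 'l',
          ('b list \<times> ('e \<times> ('c, 'k, 'p, 'l, 'd) word_elt)) set,
          ('b' list \<times> ('e' \<times> ('c', 'k', 'p', 'l', 'd') word_elt)) set) cell" where
  "hcomp A' B' C' F G H S' T' \<sigma> \<tau> =
     \<lparr>CSt = CSt \<sigma> \<times>\<^sub>f CSt \<tau>,
      CMap = (\<lambda>(a, (q, p), (q', p'), c). coend_map (star B')
        (comp_integrand A' B' C' S' T' (Fob F a) (Fob (CSt \<sigma> \<times>\<^sub>f CSt \<tau>) (q, p))
           (Fob (CSt \<sigma> \<times>\<^sub>f CSt \<tau>) (q', p')) (Fob (star_func H) c))
        (\<lambda>(bs, (x, y)). (Fob (star_func G) bs,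
           (CMap \<sigma> (a, q, q', bs) x, ext_cell B' C' G H T' \<tau> (bs, p, p', c) y))))\<rparr>"


section \<open>Unitors\<close>

definition fst_func :: "('o \<times> 'p, 'm \<times> 'n, 'o, 'm) func" where
  "fst_func = \<lparr>Fob = fst, Far = fst\<rparr>"

definition snd_func :: "('o \<times> 'p, 'm \<times> 'n, 'p, 'n) func" where
  "snd_func = \<lparr>Fob = snd, Far = snd\<rparr>"

text \<open>For \<open>T : A \<leadsto> B\<close>, the cell from \<open>loose_comp A A B (loose_id A) T\<close> to \<open>T\<close> over identities: the
  co-Yoneda isomorphism sends the class of \<open>(f, y)\<close> with \<open>f : \<a> \<rightarrow> [a]\<close> and \<open>y \<in> t(\<a>; q, q')[c]\<close>
  to \<open>t(f) y \<in> t([a]; q, q')[c] = t(a; q, q')[c]\<close>.\<close>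

definition unitor_pre ::
    "('a, 'f) cat \<Rightarrow> ('b, 'g) cat \<Rightarrow> ('a, 'f, 'b, 'g, 'q, 'h, 'e) transducer
      \<Rightarrow> ('a, 'b, unit \<times> 'q, unit \<times> 'h, 'q, 'h,
          ('a list \<times> ('f list \<times> ('b, 'g, 'q, 'h, 'e) word_elt)) set, 'e) cell" where
  "unitor_pre A B T =
     \<lparr>CSt = snd_func,
      CMap = (\<lambda>(a, (_, q), (_, q'), c). coend_desc (\<lambda>(as, (f, y)).
        case Act (ext A B T) (f, Idt (St T) q, Idt (St T) q', Idt (star B) c) y of
          Letter x \<Rightarrow> x))\<rparr>"

text \<open>The canonical map \<open>\<iota>(\<b>)[c] \<rightarrow> B\<^sup>*(c, \<b>)\<close>: it tensors the given arrows \<open>c\<^sub>i \<rightarrow> [b\<^sub>i]\<close> and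
  precomposes with the given \<open>c \<rightarrow> c\<^sub>1 @ \<dots> @ c\<^sub>n\<close>.\<close>

definition loose_id_word ::
    "('b, 'g) cat \<Rightarrow> ('b, 'g, unit, unit, 'g list) word_elt \<Rightarrow> 'g list" where
  "loose_id_word B e = (case e of
       Empty_word _ k \<Rightarrow> k
     | Letter k \<Rightarrow> k
     | Word X \<Rightarrow> coend_desc (\<lambda>(_, D). coend_desc
         (\<lambda>(_, (ks, k)). Cmp (star B) (concat ks) k) D) X)"

text \<open>For \<open>T : A \<leadsto> B\<close>, the cell from \<open>loose_comp A B B T (loose_id B)\<close> to \<open>T\<close> over identities: it
  sends the class of \<open>x \<in> t(a; q, q')[\<b>]\<close> and \<open>k \<in> \<iota>(\<b>)[c] \<cong> B\<^sup>*(c, \<b>)\<close> to \<open>x\<close> restricted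
  along \<open>k\<close>.\<close>

definition unitor_post ::
    "('a, 'f) cat \<Rightarrow> ('b, 'g) cat \<Rightarrow> ('a, 'f, 'b, 'g, 'q, 'h, 'e) transducer
      \<Rightarrow> ('a, 'b, 'q \<times> unit, 'h \<times> unit, 'q, 'h,
          ('b list \<times> ('e \<times> ('b, 'g, unit, unit, 'g list) word_elt)) set, 'e) cell" where
  "unitor_post A B T =
     \<lparr>CSt = fst_func,
      CMap = (\<lambda>(a, (q, _), (q', _), c). coend_desc (\<lambda>(bs, (x, y)).
        Act (Tr T) (Idt A a, Idt (St T) q, Idt (St T) q', loose_id_word B y) x))\<rparr>"


section \<open>Companions and conjoints of 2-transducers\<close>

text \<open>The horizontal equations are stated with the unitors made explicit: horizontal composite
  followed by the unitor of its target equals the unitor of its source followed by the identity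
  cell.\<close>

definition is_companion ::
    "('a, 'f) cat \<Rightarrow> ('b, 'g) cat \<Rightarrow> ('a, 'f, 'b, 'g) func
      \<Rightarrow> ('a, 'f, 'b, 'g, 'q, 'h, 'e) transducer \<Rightarrow> bool" where
  "is_companion A B F T \<longleftrightarrow> is_transducer A B T \<and>
     (\<exists>\<eta> \<epsilon>.
        is_cell A A A B (id_func A) F (loose_id A) T \<eta> \<and>
        is_cell A B B B F (id_func B) T (loose_id B) \<epsilon> \<and>
        cell_eq A A (loose_id A) (vcomp (id_func A) F \<eta> \<epsilon>) (tight_id_cell F) \<and>
        cell_eq A B (loose_comp A A B (loose_id A) T)
          (vcomp (id_func A) (id_func B)
             (hcomp A B B (id_func A) F (id_func B) T (loose_id B) \<eta> \<epsilon>) (unitor_post A B T))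
          (vcomp (id_func A) (id_func B) (unitor_pre A B T) (id_cell T)))"

definition is_conjoint ::
    "('a, 'f) cat \<Rightarrow> ('b, 'g) cat \<Rightarrow> ('a, 'f, 'b, 'g) func
      \<Rightarrow> ('b, 'g, 'a, 'f, 'q, 'h, 'e) transducer \<Rightarrow> bool" where
  "is_conjoint A B F T \<longleftrightarrow> is_transducer B A T \<and>
     (\<exists>\<epsilon> \<eta>.
        is_cell B A B B (id_func B) F T (loose_id B) \<epsilon> \<and>
        is_cell A A B A F (id_func A) (loose_id A) T \<eta> \<and>
        cell_eq A A (loose_id A) (vcomp F (id_func A) \<eta> \<epsilon>) (tight_id_cell F) \<and>
        cell_eq B A (loose_comp B A A T (loose_id A))
          (vcomp (id_func B) (id_func A)
             (hcomp B B A (id_func B) F (id_func A) (loose_id B) T \<epsilon> \<eta>) (unitor_pre B A T))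
          (vcomp (id_func B) (id_func A) (unitor_post B A T) (id_cell T)))"


section \<open>The double category of profunctors\<close>

text \<open>A profunctor \<open>p : A \<times> B\<^sup>o\<^sup>p \<rightarrow> Set\<close> is a loose arrow from \<open>A\<close> to \<open>B\<close>. A cell from \<open>p\<close> to \<open>p'\<close>
  over \<open>(F, G)\<close> is a natural family of maps \<open>p(a, b) \<rightarrow> p'(F a, G b)\<close>.\<close>

type_synonym ('a, 'f, 'b, 'g, 'e) prof = "('a \<times> 'b, 'f \<times> 'g, 'e) sfun"

definition is_prof :: "('a, 'f) cat \<Rightarrow> ('b, 'g) cat \<Rightarrow> ('a, 'f, 'b, 'g, 'e) prof \<Rightarrow> bool" where
  "is_prof A B p \<longleftrightarrow> is_sfun (A \<times>\<^sub>C op_cat B) p"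

definition prof_comp_integrand ::
    "('a, 'f) cat \<Rightarrow> ('c, 'k) cat \<Rightarrow> ('a, 'f, 'b, 'g, 'e) prof \<Rightarrow> ('b, 'g, 'c, 'k, 'd) prof
      \<Rightarrow> 'a \<Rightarrow> 'c \<Rightarrow> ('b \<times> 'b, 'g \<times> 'g, 'e \<times> 'd) sfun" where
  "prof_comp_integrand A C p r a c =
     \<lparr>Val = (\<lambda>(b, b'). Val p (a, b) \<times> Val r (b', c)),
      Act = (\<lambda>(\<gamma>, \<gamma>'). map_prod (Act p (Idt A a, \<gamma>)) (Act r (\<gamma>', Idt C c)))\<rparr>"

definition prof_comp ::
    "('a, 'f) cat \<Rightarrow> ('b, 'g) cat \<Rightarrow> ('c, 'k) cat
      \<Rightarrow> ('a, 'f, 'b, 'g, 'e) prof \<Rightarrow> ('b, 'g, 'c, 'k, 'd) prof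
      \<Rightarrow> ('a, 'f, 'c, 'k, ('b \<times> ('e \<times> 'd)) set) prof" where
  "prof_comp A B C p r =
     \<lparr>Val = (\<lambda>(a, c). coend B (prof_comp_integrand A C p r a c)),
      Act = (\<lambda>(f, k). coend_map B (prof_comp_integrand A C p r (Cod A f) (Dom C k))
        (\<lambda>(b, (x, y)). (b, (Act p (f, Idt B b) x, Act r (Idt B b, k) y))))\<rparr>"

definition prof_id :: "('a, 'f) cat \<Rightarrow> ('a, 'f, 'a, 'f, 'f) prof" where
  "prof_id A = \<lparr>Val = (\<lambda>(a, a'). Hom A a' a), Act = (\<lambda>(f, g) k. Cmp A f (Cmp A k g))\<rparr>"

definition is_prof_cell ::
    "('a, 'f) cat \<Rightarrow> ('b, 'g) cat \<Rightarrow> ('a', 'f') cat \<Rightarrow> ('b', 'g') cat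
      \<Rightarrow> ('a, 'f, 'a', 'f') func \<Rightarrow> ('b, 'g, 'b', 'g') func
      \<Rightarrow> ('a, 'f, 'b, 'g, 'e) prof \<Rightarrow> ('a', 'f', 'b', 'g', 'd) prof
      \<Rightarrow> ('a \<times> 'b \<Rightarrow> 'e \<Rightarrow> 'd) \<Rightarrow> bool" where
  "is_prof_cell A B A' B' F G p r \<sigma> \<longleftrightarrow>
     is_functor A A' F \<and> is_functor B B' G \<and>
     is_natural (A \<times>\<^sub>C op_cat B) p (pullback_sfun (F \<times>\<^sub>f G) r) \<sigma>"

definition prof_cell_eq ::
    "('a, 'f) cat \<Rightarrow> ('b, 'g) cat \<Rightarrow> ('a, 'f, 'b, 'g, 'e) prof
      \<Rightarrow> ('a \<times> 'b \<Rightarrow> 'e \<Rightarrow> 'd) \<Rightarrow> ('a \<times> 'b \<Rightarrow> 'e \<Rightarrow> 'd) \<Rightarrow> bool" where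
  "prof_cell_eq A B p \<sigma> \<tau> \<longleftrightarrow> (\<forall>i\<in>Ob (A \<times>\<^sub>C op_cat B). \<forall>e\<in>Val p i. \<sigma> i e = \<tau> i e)"

definition prof_vcomp ::
    "('a, 'f, 'a', 'f') func \<Rightarrow> ('b, 'g, 'b', 'g') func
      \<Rightarrow> ('a \<times> 'b \<Rightarrow> 'e \<Rightarrow> 'd) \<Rightarrow> ('a' \<times> 'b' \<Rightarrow> 'd \<Rightarrow> 'c) \<Rightarrow> 'a \<times> 'b \<Rightarrow> 'e \<Rightarrow> 'c" where
  "prof_vcomp F G \<sigma> \<tau> = (\<lambda>i e. \<tau> (Fob (F \<times>\<^sub>f G) i) (\<sigma> i e))"

definition prof_hcomp ::
    "('a', 'f') cat \<Rightarrow> ('b', 'g') cat \<Rightarrow> ('c', 'k') cat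
      \<Rightarrow> ('a, 'f, 'a', 'f') func \<Rightarrow> ('b, 'g, 'b', 'g') func \<Rightarrow> ('c, 'k, 'c', 'k') func
      \<Rightarrow> ('a', 'f', 'b', 'g', 'e') prof \<Rightarrow> ('b', 'g', 'c', 'k', 'd') prof
      \<Rightarrow> ('a \<times> 'b \<Rightarrow> 'e \<Rightarrow> 'e') \<Rightarrow> ('b \<times> 'c \<Rightarrow> 'd \<Rightarrow> 'd')
      \<Rightarrow> 'a \<times> 'c \<Rightarrow> ('b \<times> ('e \<times> 'd)) set \<Rightarrow> ('b' \<times> ('e' \<times> 'd')) set" where
  "prof_hcomp A' B' C' F G H p' r' \<sigma> \<tau> = (\<lambda>(a, c).
     coend_map B' (prof_comp_integrand A' C' p' r' (Fob F a) (Fob H c))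
       (\<lambda>(b, (x, y)). (Fob G b, (\<sigma> (a, b) x, \<tau> (b, c) y))))"

definition prof_unitor_pre ::
    "('b, 'g) cat \<Rightarrow> ('a, 'f, 'b, 'g, 'e) prof
      \<Rightarrow> 'a \<times> 'b \<Rightarrow> ('a \<times> ('f \<times> 'e)) set \<Rightarrow> 'e" where
  "prof_unitor_pre B p = (\<lambda>(a, b). coend_desc (\<lambda>(_, (f, y)). Act p (f, Idt B b) y))"

definition prof_unitor_post ::
    "('a, 'f) cat \<Rightarrow> ('a, 'f, 'b, 'g, 'e) prof
      \<Rightarrow> 'a \<times> 'b \<Rightarrow> ('b \<times> ('e \<times> 'g)) set \<Rightarrow> 'e" where
  "prof_unitor_post A p = (\<lambda>(a, b). coend_desc (\<lambda>(_, (x, g)). Act p (Idt A a, g) x))"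

definition is_prof_companion ::
    "('a, 'f) cat \<Rightarrow> ('b, 'g) cat \<Rightarrow> ('a, 'f, 'b, 'g) func
      \<Rightarrow> ('a, 'f, 'b, 'g, 'e) prof \<Rightarrow> bool" where
  "is_prof_companion A B F p \<longleftrightarrow> is_prof A B p \<and>
     (\<exists>\<eta> \<epsilon>.
        is_prof_cell A A A B (id_func A) F (prof_id A) p \<eta> \<and>
        is_prof_cell A B B B F (id_func B) p (prof_id B) \<epsilon> \<and>
        prof_cell_eq A A (prof_id A) (prof_vcomp (id_func A) F \<eta> \<epsilon>) (\<lambda>_. Far F) \<and>
        prof_cell_eq A B (prof_comp A A B (prof_id A) p)
          (prof_vcomp (id_func A) (id_func B)
             (prof_hcomp A B B (id_func A) F (id_func B) p (prof_id B) \<eta> \<epsilon>) (prof_unitor_post A p))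
          (prof_vcomp (id_func A) (id_func B) (prof_unitor_pre B p) (\<lambda>_ e. e)))"

definition is_prof_conjoint ::
    "('a, 'f) cat \<Rightarrow> ('b, 'g) cat \<Rightarrow> ('a, 'f, 'b, 'g) func
      \<Rightarrow> ('b, 'g, 'a, 'f, 'e) prof \<Rightarrow> bool" where
  "is_prof_conjoint A B F p \<longleftrightarrow> is_prof B A p \<and>
     (\<exists>\<epsilon> \<eta>.
        is_prof_cell B A B B (id_func B) F p (prof_id B) \<epsilon> \<and>
        is_prof_cell A A B A F (id_func A) (prof_id A) p \<eta> \<and>
        prof_cell_eq A A (prof_id A) (prof_vcomp F (id_func A) \<eta> \<epsilon>) (\<lambda>_. Far F) \<and>
        prof_cell_eq B A (prof_comp B A A p (prof_id A))
          (prof_vcomp (id_func B) (id_func A)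
             (prof_hcomp B B A (id_func B) F (id_func A) (prof_id B) p \<epsilon> \<eta>) (prof_unitor_pre A p))
          (prof_vcomp (id_func B) (id_func A) (prof_unitor_post B p) (\<lambda>_ e. e)))"

text \<open>The profunctors \<open>B(b, F a)\<close> and \<open>B(F a, b)\<close>.\<close>

definition prof_companion ::
    "('b, 'g) cat \<Rightarrow> ('a, 'f, 'b, 'g) func \<Rightarrow> ('a, 'f, 'b, 'g, 'g) prof" where
  "prof_companion B F =
     \<lparr>Val = (\<lambda>(a, b). Hom B b (Fob F a)), Act = (\<lambda>(f, g) k. Cmp B (Far F f) (Cmp B k g))\<rparr>"

definition prof_conjoint ::
    "('b, 'g) cat \<Rightarrow> ('a, 'f, 'b, 'g) func \<Rightarrow> ('b, 'g, 'a, 'f, 'g) prof" where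
  "prof_conjoint B F =
     \<lparr>Val = (\<lambda>(b, a). Hom B (Fob F a) b), Act = (\<lambda>(g, f) k. Cmp B g (Cmp B k (Far F f)))\<rparr>"

text \<open>The embedding \<open>p \<mapsto> p\<close>-bar of profunctors into 2-transducers.\<close>

definition bar ::
    "('a, 'f, 'b, 'g, 'e) prof \<Rightarrow> ('a, 'f, 'b, 'g, unit, unit, 'e) transducer" where
  "bar p =
     \<lparr>St = unit_cat,
      Tr = \<lparr>Val = (\<lambda>(a, _, _, bs). case bs of [b] \<Rightarrow> Val p (a, b) | _ \<Rightarrow> {}),
            Act = (\<lambda>(f, _, _, gs) e. case gs of [g] \<Rightarrow> Act p (f, g) e | _ \<Rightarrow> e)\<rparr>\<rparr>"

end

theory Submission
  imports Defs
begin

text \<open>For profunctors the companion and conjoint cells are identities and the action of \<open>F\<close>, and by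
  co-Yoneda the horizontal equations reduce to equations on representatives of coend classes.
  For the 2-transducers of the form \<open>bar p\<close> the same equations suffice: an arrow of the free
  monoidal category ending in a one-letter list starts in a one-letter list, and \<open>bar p\<close> is empty
  on all other lengths, so every representative in the composites with \<open>\<iota>\<close> consists of letters
  and the extension to longer words never contributes.\<close>

section \<open>Maps out of coends\<close>

text \<open>Both sides of a horizontal equation are functions on equivalence classes: a unitor
  returns the common value that a map of representatives takes on a class, and a horizontal
  composite saturates an image under the relation of the target coend. Computing in these quotients
  is avoided by evaluating both sides at one representative. What remains is that each unitor is
  constant on generating pairs, and one equation between elements of p: for a companion p(1,
  \<epsilon> x)(\<eta> f) = p(f, 1) x, for a conjoint p(\<epsilon> x, 1)(\<eta> f) = p(1, f) x. The
  cells come from the shape of the representables: B(b, F a) and B(F a, b) are the hom profunctor of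
  B with F substituted in one variable. Hence the identity is a cell from them to the hom profunctor
  of B, and the action of F is a cell into them from the hom profunctor of A. In both equations each
  side is then the composite of F f with x.\<close>

definition respects_step ::
    "('o, 'm) cat \<Rightarrow> ('o \<times> 'o, 'm \<times> 'm, 'e) sfun \<Rightarrow> ('o \<times> 'e \<Rightarrow> 'd) \<Rightarrow> bool" where
  "respects_step C P \<phi> \<longleftrightarrow> (\<forall>(u, v) \<in> coend_step C P. \<phi> u = \<phi> v)"

lemma respects_stepI:
  "(\<And>z z'. (z, z') \<in> coend_step C P \<Longrightarrow> \<phi> z = \<phi> z') \<Longrightarrow> respects_step C P \<phi>"
  by (auto simp: respects_step_def)

text \<open>\<open>respects_step\<close> says that the components of \<phi> form a cowedge. Testing
  generating pairs suffices, since related elements are joined by a zigzag of such pairs and \<phi>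
  keeps its value along each link.\<close>

lemma respects_step_coend_rel:
  assumes "respects_step C P \<phi>" and "(u, v) \<in> coend_rel C P"
  shows "\<phi> u = \<phi> v"
proof -
  have "(u, v) \<in> (coend_step C P \<union> (coend_step C P)\<inverse>)\<^sup>*"
    using assms(2) by (simp add: coend_rel_def)
  then show ?thesis
    by induction (use assms(1) in \<open>auto simp: respects_step_def\<close>)
qed

lemma coend_class:
  assumes "X \<in> coend C P"
  obtains z where "z \<in> coend_carrier C P" and "z \<in> X" and "X = coend_rel C P `` {z}"
proof -
  obtain z where z: "z \<in> coend_carrier C P" "X = coend_rel C P `` {z}"
    using assms unfolding coend_def by (rule quotientE)
  moreover have "z \<in> X"
    using z by (simp add: coend_rel_def)
  ultimately show thesis
    using that by blast
qed

lemma coend_desc_eq: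
  assumes "z \<in> X" and "\<And>w. w \<in> X \<Longrightarrow> \<phi> w = \<phi> z"
  shows "coend_desc \<phi> X = \<phi> z"
proof -
  have "\<phi> ` X = (\<lambda>_. \<phi> z) ` X"
    by (rule image_cong[OF refl assms(2)])
  then have "\<phi> ` X = {\<phi> z}"
    using image_constant[OF assms(1)] by simp
  then show ?thesis
    by (simp add: coend_desc_def)
qed

text \<open>This is the bridge from classes to representatives. With z a representative of X, an
  element of the image class is related to some \<theta> w with w in X, so \<psi> takes there the
  value \<psi> (\<theta> w) = \<phi> w = \<phi> z. The pointwise equation thus transfers the
  constancy of \<phi> on X to \<psi> on the image class.\<close>

lemma coend_desc_coend_map:
  assumes X: "X \<in> coend C P"
    and \<phi>: "respects_step C P \<phi>"
    and \<psi>: "respects_step D P' \<psi>"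
    and \<theta>: "\<And>z. z \<in> coend_carrier C P \<Longrightarrow> \<theta> z \<in> coend_carrier D P' \<and> \<psi> (\<theta> z) = \<phi> z"
  shows "coend_desc \<psi> (coend_map D P' \<theta> X) = coend_desc \<phi> X"
proof -
  obtain z where z: "z \<in> coend_carrier C P" "z \<in> X" and Xz: "X = coend_rel C P `` {z}"
    using coend_class[OF X] .
  have \<phi>X: "\<phi> w = \<phi> z" if "w \<in> X" for w
    using respects_step_coend_rel[OF \<phi>, of z w] that Xz by simp
  \<comment> \<open>\<open>coend_rel\<close> is reflexive only on the carrier, which is why \<theta>
    has to land there.\<close>
  have "\<theta> z \<in> coend_map D P' \<theta> X"
    using z(2) \<theta>[OF z(1)] by (auto simp: coend_map_def coend_rel_def intro!: ImageI[of "\<theta> z"])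
  moreover have "\<psi> v = \<psi> (\<theta> z)" if v: "v \<in> coend_map D P' \<theta> X" for v
  proof -
    obtain w where w: "w \<in> X" "(\<theta> w, v) \<in> coend_rel D P'"
      using v by (auto simp: coend_map_def)
    have "w \<in> coend_carrier C P"
      using w(1) Xz by (auto simp: coend_rel_def)
    then have "\<psi> (\<theta> w) = \<psi> (\<theta> z)"
      using \<theta> z(1) \<phi>X[OF w(1)] by simp
    then show ?thesis
      using respects_step_coend_rel[OF \<psi> w(2)] by simp
  qed
  ultimately have "coend_desc \<psi> (coend_map D P' \<theta> X) = \<psi> (\<theta> z)"
    by (rule coend_desc_eq)
  also have "\<dots> = coend_desc \<phi> X"
    using \<theta>[OF z(1)] coend_desc_eq[of z X \<phi>, OF z(2) \<phi>X] by simp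
  finally show ?thesis .
qed


section \<open>Categories, functors and profunctors\<close>

lemma HomD:
  assumes "f \<in> Hom C x y"
  shows "f \<in> Arr C" and "Dom C f = x" and "Cod C f = y"
  using assms by (auto simp: Hom_def)

text \<open>The definition of \<open>small_category\<close> speaks of \<open>Arr\<close> with side
  equations between \<open>Dom\<close> and \<open>Cod\<close>. In \<open>Hom\<close> form the
  endpoints travel with the arrow, and composability is settled by unification.\<close>

lemma
  assumes C: "small_category C"
  shows Idt_Hom: "x \<in> Ob C \<Longrightarrow> Idt C x \<in> Hom C x x"
    and Cmp_Hom: "f \<in> Hom C x y \<Longrightarrow> g \<in> Hom C y z \<Longrightarrow> Cmp C g f \<in> Hom C x z"
    and Cmp_Idt_right: "f \<in> Hom C x y \<Longrightarrow> Cmp C f (Idt C x) = f"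
    and Cmp_Idt_left: "f \<in> Hom C x y \<Longrightarrow> Cmp C (Idt C y) f = f"
    and Cmp_assoc: "f \<in> Hom C x y \<Longrightarrow> g \<in> Hom C y z \<Longrightarrow> h \<in> Hom C z w \<Longrightarrow>
      Cmp C h (Cmp C g f) = Cmp C (Cmp C h g) f"
    and Hom_Ob: "f \<in> Hom C x y \<Longrightarrow> x \<in> Ob C \<and> y \<in> Ob C"
proof -
  note C' = C[unfolded small_category_def]
  note Ob' = C'[THEN conjunct1, rule_format]
    and Idt' = C'[THEN conjunct2, THEN conjunct1, rule_format]
    and Cmp' = C'[THEN conjunct2, THEN conjunct2, THEN conjunct1, rule_format]
    and unit' = C'[THEN conjunct2, THEN conjunct2, THEN conjunct2, THEN conjunct1, rule_format]
    and assoc' = C'[THEN conjunct2, THEN conjunct2, THEN conjunct2, THEN conjunct2, rule_format]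
  show "x \<in> Ob C \<Longrightarrow> Idt C x \<in> Hom C x x"
    by (rule Idt')
  show "x \<in> Ob C \<and> y \<in> Ob C" "Cmp C f (Idt C x) = f" "Cmp C (Idt C y) f = f"
    if "f \<in> Hom C x y"
    using Ob'[OF HomD(1)[OF that]] unit'[OF HomD(1)[OF that]] by (simp_all only: HomD[OF that])
  show "Cmp C g f \<in> Hom C x z" if fg: "f \<in> Hom C x y" "g \<in> Hom C y z"
    using Cmp'[OF HomD(1)[OF fg(1)] HomD(1)[OF fg(2)]]
    by (simp only: HomD[OF fg(1)] HomD[OF fg(2)])
  show "Cmp C h (Cmp C g f) = Cmp C (Cmp C h g) f"
    if fgh: "f \<in> Hom C x y" "g \<in> Hom C y z" "h \<in> Hom C z w"
    by (rule assoc') (simp_all only: HomD[OF fgh(1)] HomD[OF fgh(2)] HomD[OF fgh(3)])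
qed

lemma
  assumes F: "is_functor C D F"
  shows Fob_Ob: "x \<in> Ob C \<Longrightarrow> Fob F x \<in> Ob D"
    and Far_Hom: "f \<in> Hom C x y \<Longrightarrow> Far F f \<in> Hom D (Fob F x) (Fob F y)"
    and Far_Idt: "x \<in> Ob C \<Longrightarrow> Far F (Idt C x) = Idt D (Fob F x)"
    and Far_Cmp: "f \<in> Hom C x y \<Longrightarrow> g \<in> Hom C y z \<Longrightarrow>
      Far F (Cmp C g f) = Cmp D (Far F g) (Far F f)"
proof -
  note F' = F[unfolded is_functor_def]
  show "x \<in> Ob C \<Longrightarrow> Fob F x \<in> Ob D"
    by (rule F'[THEN conjunct1, rule_format])
  show "Far F f \<in> Hom D (Fob F x) (Fob F y)" if "f \<in> Hom C x y"
    using F'[THEN conjunct2, THEN conjunct1, rule_format, OF HomD(1)[OF that]]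
    by (simp only: HomD(2,3)[OF that])
  show "x \<in> Ob C \<Longrightarrow> Far F (Idt C x) = Idt D (Fob F x)"
    by (rule F'[THEN conjunct2, THEN conjunct2, THEN conjunct1, rule_format])
  show "Far F (Cmp C g f) = Cmp D (Far F g) (Far F f)"
    if "f \<in> Hom C x y" "g \<in> Hom C y z"
    by (rule F'[THEN conjunct2, THEN conjunct2, THEN conjunct2, rule_format])
      (simp_all only: HomD[OF that(1)] HomD[OF that(2)])
qed

lemma is_functor_id_func: "is_functor C C (id_func C)"
  by (simp add: is_functor_def id_func_def Hom_def)

lemma small_category_unit_cat: "small_category unit_cat"
  by (simp add: small_category_def unit_cat_def Hom_def)

section \<open>Profunctors and their cells, elementwise\<close>

lemma is_prof_iff:
  "is_prof A B p \<longleftrightarrow>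
    (\<forall>f\<in>Arr A. \<forall>g\<in>Arr B. \<forall>x\<in>Val p (Dom A f, Cod B g).
       Act p (f, g) x \<in> Val p (Cod A f, Dom B g)) \<and>
    (\<forall>a\<in>Ob A. \<forall>b\<in>Ob B. \<forall>x\<in>Val p (a, b). Act p (Idt A a, Idt B b) x = x) \<and>
    (\<forall>f\<in>Arr A. \<forall>g\<in>Arr B. \<forall>f'\<in>Arr A. \<forall>g'\<in>Arr B.
       Cod A f = Dom A f' \<longrightarrow> Dom B g = Cod B g' \<longrightarrow>
       (\<forall>x\<in>Val p (Dom A f, Cod B g).
          Act p (Cmp A f' f, Cmp B g g') x = Act p (f', g') (Act p (f, g) x)))"
  by (simp add: is_prof_def is_sfun_def prod_cat_def op_cat_def imp_conjL)

text \<open>\<open>Act_prof_Cmp\<close> is reversed compared with the functor law in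
  \<open>is_sfun\<close>: as a rewrite rule it fuses successive actions, which is what the co-Yoneda
  computations require.\<close>

lemma
  assumes "is_prof A B p"
  shows Act_prof: "f \<in> Hom A a a' \<Longrightarrow> g \<in> Hom B b' b \<Longrightarrow> x \<in> Val p (a, b) \<Longrightarrow>
      Act p (f, g) x \<in> Val p (a', b')"
    and Act_prof_Idt: "a \<in> Ob A \<Longrightarrow> b \<in> Ob B \<Longrightarrow> x \<in> Val p (a, b) \<Longrightarrow>
      Act p (Idt A a, Idt B b) x = x"
    and Act_prof_Cmp: "f \<in> Hom A a a' \<Longrightarrow> f' \<in> Hom A a' a'' \<Longrightarrow>
      g \<in> Hom B b' b \<Longrightarrow> g' \<in> Hom B b'' b' \<Longrightarrow> x \<in> Val p (a, b) \<Longrightarrow>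
      Act p (f', g') (Act p (f, g) x) = Act p (Cmp A f' f, Cmp B g g') x"
  using assms unfolding is_prof_iff Hom_def by auto

lemma is_profI:
  assumes "\<And>a a' b b' f g x. f \<in> Hom A a a' \<Longrightarrow> g \<in> Hom B b' b \<Longrightarrow> x \<in> Val p (a, b) \<Longrightarrow>
      Act p (f, g) x \<in> Val p (a', b')"
    and "\<And>a b x. a \<in> Ob A \<Longrightarrow> b \<in> Ob B \<Longrightarrow> x \<in> Val p (a, b) \<Longrightarrow>
      Act p (Idt A a, Idt B b) x = x"
    and "\<And>a a' a'' b b' b'' f f' g g' x. f \<in> Hom A a a' \<Longrightarrow> f' \<in> Hom A a' a'' \<Longrightarrow>
      g \<in> Hom B b' b \<Longrightarrow> g' \<in> Hom B b'' b' \<Longrightarrow> x \<in> Val p (a, b) \<Longrightarrow>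
      Act p (f', g') (Act p (f, g) x) = Act p (Cmp A f' f, Cmp B g g') x"
  shows "is_prof A B p"
  unfolding is_prof_iff by (intro conjI ballI impI; (rule assms | rule assms(3)[symmetric]); simp add: Hom_def)

lemma is_prof_cellI:
  assumes "is_functor A A' F" and "is_functor B B' G"
    and "\<And>a b x. a \<in> Ob A \<Longrightarrow> b \<in> Ob B \<Longrightarrow> x \<in> Val p (a, b) \<Longrightarrow>
      \<sigma> (a, b) x \<in> Val r (Fob F a, Fob G b)"
    and "\<And>a a' b b' f g x. f \<in> Hom A a a' \<Longrightarrow> g \<in> Hom B b' b \<Longrightarrow> x \<in> Val p (a, b) \<Longrightarrow>
      \<sigma> (a', b') (Act p (f, g) x) = Act r (Far F f, Far G g) (\<sigma> (a, b) x)"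
  shows "is_prof_cell A B A' B' F G p r \<sigma>"
  using assms unfolding is_prof_cell_def is_natural_def prod_cat_def op_cat_def Hom_def
    pullback_sfun_def prod_func_def
  by auto

lemma
  assumes "is_prof_cell A B A' B' F G p r \<sigma>"
  shows prof_cell_Val: "a \<in> Ob A \<Longrightarrow> b \<in> Ob B \<Longrightarrow> x \<in> Val p (a, b) \<Longrightarrow>
      \<sigma> (a, b) x \<in> Val r (Fob F a, Fob G b)"
    and prof_cell_Act: "f \<in> Hom A a a' \<Longrightarrow> g \<in> Hom B b' b \<Longrightarrow> x \<in> Val p (a, b) \<Longrightarrow>
      \<sigma> (a', b') (Act p (f, g) x) = Act r (Far F f, Far G g) (\<sigma> (a, b) x)"
  using assms unfolding is_prof_cell_def is_natural_def prod_cat_def op_cat_def Hom_def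
    pullback_sfun_def prod_func_def
  by auto

section \<open>Co-Yoneda for profunctors: the unitors are constant on classes\<close>

lemma respects_step_prof_unitor_post:
  assumes "small_category A" and "small_category B" and p: "is_prof A B p"
    and a: "a \<in> Ob A" and c: "c \<in> Ob B"
  shows "respects_step B (prof_comp_integrand A B p (prof_id B) a c)
    (\<lambda>(_, (x, g)). Act p (Idt A a, g) x)"
proof -
  note A = assms(1) and B = assms(2)
  \<comment> \<open>A generating pair joins (p(1, f) x, g) to (x, f o g), and both evaluate to p(1,
    f o g) x. The remaining identities are written out by the two-sided action of
    \<open>prof_id\<close> and by the variables that stay fixed.\<close>
  have "Act p (Idt A a, Cmp B (Idt B (Dom B f)) (Cmp B g (Idt B c))) (Act p (Idt A a, f) x)
      = Act p (Idt A a, Cmp B f (Cmp B g (Idt B c))) (Act p (Idt A a, Idt B (Cod B f)) x)"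
    if "f \<in> Arr B" "x \<in> Val p (a, Cod B f)" "g \<in> Hom B c (Dom B f)" for f x g
  proof -
    have f: "f \<in> Hom B (Dom B f) (Cod B f)"
      using that(1) by (simp add: Hom_def)
    show ?thesis
      using that f Hom_Ob[OF B f]
      by (simp add: Act_prof_Cmp[OF p Idt_Hom[OF A a] Idt_Hom[OF A a]] Act_prof_Idt[OF p a]
          Cmp_Idt_left[OF B] Cmp_Idt_right[OF B] Cmp_Idt_left[OF A Idt_Hom[OF A a]])
  qed
  then show ?thesis
    by (auto simp: respects_step_def coend_step_def prof_comp_integrand_def prof_id_def)
qed

lemma respects_step_prof_unitor_pre:
  assumes "small_category A" and "small_category B" and p: "is_prof A B p"
    and a: "a \<in> Ob A" and c: "c \<in> Ob B"
  shows "respects_step A (prof_comp_integrand A B (prof_id A) p a c)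
    (\<lambda>(_, (f, y)). Act p (f, Idt B c) y)"
proof -
  note A = assms(1) and B = assms(2)
  \<comment> \<open>Here the pair joins (k o f, y) to (k, p(f, 1) y), with common value p(k o f, 1)
    y.\<close>
  have "Act p (Cmp A (Idt A a) (Cmp A k f), Idt B c) (Act p (Idt A (Dom A f), Idt B c) y)
      = Act p (Cmp A (Idt A a) (Cmp A k (Idt A (Cod A f))), Idt B c) (Act p (f, Idt B c) y)"
    if "f \<in> Arr A" "y \<in> Val p (Dom A f, c)" "k \<in> Hom A (Cod A f) a" for f y k
  proof -
    have f: "f \<in> Hom A (Dom A f) (Cod A f)"
      using that(1) by (simp add: Hom_def)
    show ?thesis
      using that f Hom_Ob[OF A f] Cmp_Hom[OF A f that(3)]
      by (simp add: Act_prof_Cmp[OF p f that(3) Idt_Hom[OF B c] Idt_Hom[OF B c]]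
          Act_prof_Idt[OF p _ c]
          Cmp_Idt_left[OF A] Cmp_Idt_right[OF A] Cmp_Idt_left[OF B Idt_Hom[OF B c]])
  qed
  then show ?thesis
    by (auto simp: respects_step_def coend_step_def prof_comp_integrand_def prof_id_def)
qed


section \<open>The embedding of profunctors\<close>

text \<open>\<open>Dom\<close> and \<open>Cod\<close> of \<open>star C\<close> are maps over the
  same list of components, so the length of either end determines that of the other.\<close>

lemma Hom_star_singletonE:
  assumes "f \<in> Hom (star C) xs [y]"
  obtains x g where "xs = [x]" and "f = [g]" and "g \<in> Hom C x y"
  using assms by (auto simp: Hom_def star_def map_eq_Cons_conv)

lemma Hom_star_singleton_iff [simp]: "[f] \<in> Hom (star C) [x] [y] \<longleftrightarrow> f \<in> Hom C x y"
  by (auto simp: Hom_def star_def)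

lemma Val_bar: "x \<in> Val (Tr (bar p)) (a, u, u', bs) \<longleftrightarrow> (\<exists>b. bs = [b] \<and> x \<in> Val p (a, b))"
  by (auto simp: bar_def split: list.splits)

lemma Act_bar [simp]: "Act (Tr (bar p)) (f, u, u', [g]) x = Act p (f, g) x"
  by (simp add: bar_def)

lemma St_bar [simp]: "St (bar p) = unit_cat"
  by (simp add: bar_def)

lemma td_index_simps [simp]:
  "Dom (td_index A Q B) (f, u, u', gs) = (Dom A f, Cod Q u, Dom Q u', map (Cod B) gs)"
  "Cod (td_index A Q B) (f, u, u', gs) = (Cod A f, Dom Q u, Cod Q u', map (Dom B) gs)"
  "Idt (td_index A Q B) (a, q, q', bs) = (Idt A a, Idt Q q, Idt Q q', map (Idt B) bs)"
  "Cmp (td_index A Q B) (f', v, v', gs') (f, u, u', gs) =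
    (Cmp A f' f, Cmp Q u v, Cmp Q v' u', map2 (Cmp B) gs gs')"
  "(a, q, q', bs) \<in> Ob (td_index A Q B) \<longleftrightarrow>
    a \<in> Ob A \<and> q \<in> Ob Q \<and> q' \<in> Ob Q \<and> bs \<in> lists (Ob B)"
  "(f, u, u', gs) \<in> Arr (td_index A Q B) \<longleftrightarrow>
    f \<in> Arr A \<and> u \<in> Arr Q \<and> u' \<in> Arr Q \<and> gs \<in> lists (Arr B)"
  by (simp_all add: td_index_def prod_cat_def op_cat_def star_def)

lemma unit_cat_simps [simp]:
  "Ob unit_cat = {()}" "Arr unit_cat = {()}"
  by (simp_all add: unit_cat_def)

text \<open>An element at the domain of an index arrow forces its list of letters to have length
  one, so the default branch in the action of \<open>bar p\<close> is never applied to an element.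
  The letter \<open>g\<close> starts from \<open>Cod B g\<close> because lists enter
  contravariantly.\<close>

lemma bar_arrE:
  assumes "i \<in> Arr (td_index A unit_cat B)"
    and "x \<in> Val (Tr (bar p)) (Dom (td_index A unit_cat B) i)"
  obtains f g where "i = (f, (), (), [g])" and "f \<in> Hom A (Dom A f) (Cod A f)"
    and "g \<in> Hom B (Dom B g) (Cod B g)" and "x \<in> Val p (Dom A f, Cod B g)"
proof -
  obtain f u u' gs where i: "i = (f, u, u', gs)"
    by (cases i)
  then obtain b where "map (Cod B) gs = [b]" "x \<in> Val p (Dom A f, b)"
    using assms(2) by (auto simp: Val_bar)
  then show thesis
    using that[of f] assms(1) i by (auto simp: map_eq_Cons_conv Hom_def)
qed

lemma bar_obE:
  assumes "i \<in> Ob (td_index A unit_cat B)" and "x \<in> Val (Tr (bar p)) i"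
  obtains a b where "i = (a, (), (), [b])" and "a \<in> Ob A" and "b \<in> Ob B"
    and "x \<in> Val p (a, b)"
  using assms by (cases i) (auto simp: Val_bar)

lemma loose_id_arrE:
  assumes "i \<in> Arr (td_index A unit_cat A)"
    and "k \<in> Val (Tr (loose_id A)) (Dom (td_index A unit_cat A) i)"
  obtains f g k' where "i = (f, (), (), [g])" and "k = [k']"
    and "f \<in> Hom A (Dom A f) (Cod A f)" and "g \<in> Hom A (Dom A g) (Cod A g)"
    and "k' \<in> Hom A (Cod A g) (Dom A f)"
proof -
  obtain f u u' gs where i: "i = (f, u, u', gs)"
    by (cases i)
  then have "k \<in> Hom (star A) (map (Cod A) gs) [Dom A f]"
    using assms(2) by (simp add: loose_id_def)
  then obtain a k' where "map (Cod A) gs = [a]" "k = [k']" "k' \<in> Hom A a (Dom A f)"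
    by (rule Hom_star_singletonE)
  then show thesis
    \<comment> \<open>The instance of \<open>Hom_def\<close> matches only sources of the form
      \<open>Dom _ _\<close>, so the membership of \<open>k'\<close> stays folded.\<close>
    using that[of f] assms(1) i by (auto simp: map_eq_Cons_conv Hom_def[of _ "Dom _ _"])
qed

lemma loose_id_obE:
  assumes "i \<in> Ob (td_index A unit_cat A)" and "k \<in> Val (Tr (loose_id A)) i"
  obtains a a' k' where "i = (a, (), (), [a'])" and "k = [k']" and "a \<in> Ob A" and "a' \<in> Ob A"
    and "k' \<in> Hom A a' a"
  using assms by (cases i) (auto simp: loose_id_def elim!: Hom_star_singletonE)

lemma is_transducer_bar:
  assumes p: "is_prof A B p"
  shows "is_transducer A B (bar p)"
proof -
  let ?I = "td_index A unit_cat B"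
  have "is_sfun ?I (Tr (bar p))"
    unfolding is_sfun_def
  proof (intro conjI ballI impI)
    fix i x
    assume "i \<in> Arr ?I" "x \<in> Val (Tr (bar p)) (Dom ?I i)"
    then show "Act (Tr (bar p)) i x \<in> Val (Tr (bar p)) (Cod ?I i)"
      by (rule bar_arrE) (simp add: Val_bar Act_prof[OF p])
  next
    fix i x
    assume "i \<in> Ob ?I" "x \<in> Val (Tr (bar p)) i"
    then show "Act (Tr (bar p)) (Idt ?I i) x = x"
      by (rule bar_obE) (simp add: Act_prof_Idt[OF p])
  next
    fix i j x
    assume i: "i \<in> Arr ?I" "x \<in> Val (Tr (bar p)) (Dom ?I i)"
      and j: "j \<in> Arr ?I" "Cod ?I i = Dom ?I j"
    obtain f g where f: "i = (f, (), (), [g])" "f \<in> Hom A (Dom A f) (Cod A f)"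
      "g \<in> Hom B (Dom B g) (Cod B g)" "x \<in> Val p (Dom A f, Cod B g)"
      using bar_arrE[OF i] .
    \<comment> \<open>No element at the domain of \<open>j\<close> is given; its list has length one
      because \<open>j\<close> is composable with \<open>i\<close>.\<close>
    obtain f' g' where f': "j = (f', (), (), [g'])" "f' \<in> Hom A (Cod A f) (Cod A f')"
      "g' \<in> Hom B (Dom B g') (Dom B g)"
      using j f(1) by (cases j) (auto simp: map_eq_Cons_conv Hom_def)
    show "Act (Tr (bar p)) (Cmp ?I j i) x = Act (Tr (bar p)) j (Act (Tr (bar p)) i x)"
      using f f' by (simp add: Act_prof_Cmp[OF p f(2) f'(2) f(3) f'(3) f(4)])
  qed
  then show ?thesis
    by (simp add: is_transducer_def small_category_unit_cat)
qed

text \<open>\<open>hd\<close> makes the maps total. On elements it loses nothing: an arrow of lists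
  into \<open>[a]\<close> has a single component and starts at a single letter. The counit cell
  below conversely wraps its value in a one-element list, as elements of a loose identity are arrows
  of lists.\<close>

definition bar_unit_cell ::
    "('a \<times> 'a \<Rightarrow> 'f \<Rightarrow> 'e) \<Rightarrow> ('a, 'a, unit, unit, unit, unit, 'f list, 'e) cell" where
  "bar_unit_cell \<sigma> = \<lparr>CSt = id_func unit_cat, CMap = (\<lambda>(a, _, _, as) k. \<sigma> (a, hd as) (hd k))\<rparr>"

definition bar_counit_cell ::
    "('a \<times> 'b \<Rightarrow> 'e \<Rightarrow> 'g) \<Rightarrow> ('a, 'b, unit, unit, unit, unit, 'e, 'g list) cell" where
  "bar_counit_cell \<sigma> = \<lparr>CSt = id_func unit_cat, CMap = (\<lambda>(a, _, _, bs) x. [\<sigma> (a, hd bs) x])\<rparr>"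

lemma is_cell_bar_unit_cell:
  assumes \<sigma>: "is_prof_cell A A A' B' F G (prof_id A) p \<sigma>"
  shows "is_cell A A A' B' F G (loose_id A) (bar p) (bar_unit_cell \<sigma>)"
proof -
  let ?I = "td_index A unit_cat A"
  let ?J = "F \<times>\<^sub>f id_func unit_cat \<times>\<^sub>f id_func unit_cat \<times>\<^sub>f star_func G"
  have "is_natural ?I (Tr (loose_id A)) (pullback_sfun ?J (Tr (bar p))) (CMap (bar_unit_cell \<sigma>))"
    unfolding is_natural_def
  proof (intro conjI ballI)
    fix i k
    assume "i \<in> Ob ?I" "k \<in> Val (Tr (loose_id A)) i"
    then show "CMap (bar_unit_cell \<sigma>) i k \<in> Val (pullback_sfun ?J (Tr (bar p))) i"
      by (rule loose_id_obE)
        (simp add: bar_unit_cell_def pullback_sfun_def prod_func_def star_func_def Val_bar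
          prof_cell_Val[OF \<sigma>] prof_id_def)
  next
    fix i k
    assume "i \<in> Arr ?I" "k \<in> Val (Tr (loose_id A)) (Dom ?I i)"
    then obtain f g k' where i: "i = (f, (), (), [g])" "k = [k']"
      "f \<in> Hom A (Dom A f) (Cod A f)" "g \<in> Hom A (Dom A g) (Cod A g)"
      "k' \<in> Hom A (Cod A g) (Dom A f)"
      by (rule loose_id_arrE)
    have "k' \<in> Val (prof_id A) (Dom A f, Cod A g)"
      using i(5) by (simp add: prof_id_def)
    from prof_cell_Act[OF \<sigma> i(3,4) this]
    show "CMap (bar_unit_cell \<sigma>) (Cod ?I i) (Act (Tr (loose_id A)) i k) =
        Act (pullback_sfun ?J (Tr (bar p))) i (CMap (bar_unit_cell \<sigma>) (Dom ?I i) k)"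
      by (simp add: i(1,2) bar_unit_cell_def pullback_sfun_def prod_func_def star_func_def
          prof_id_def loose_id_def star_def)
  qed
  moreover have "is_functor A A' F" "is_functor A B' G"
    using \<sigma> by (simp_all add: is_prof_cell_def)
  ultimately show ?thesis
    using is_functor_id_func[of unit_cat]
    by (simp add: is_cell_def bar_unit_cell_def loose_id_def)
qed

lemma is_cell_bar_counit_cell:
  assumes \<sigma>: "is_prof_cell A B A' A' F G p (prof_id A') \<sigma>"
  shows "is_cell A B A' A' F G (bar p) (loose_id A') (bar_counit_cell \<sigma>)"
proof -
  let ?I = "td_index A unit_cat B"
  let ?J = "F \<times>\<^sub>f id_func unit_cat \<times>\<^sub>f id_func unit_cat \<times>\<^sub>f star_func G"
  have "is_natural ?I (Tr (bar p)) (pullback_sfun ?J (Tr (loose_id A')))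
      (CMap (bar_counit_cell \<sigma>))"
    unfolding is_natural_def
  proof (intro conjI ballI)
    fix i x
    assume "i \<in> Ob ?I" "x \<in> Val (Tr (bar p)) i"
    then obtain a b where i: "i = (a, (), (), [b])" "a \<in> Ob A" "b \<in> Ob B" "x \<in> Val p (a, b)"
      by (rule bar_obE)
    from prof_cell_Val[OF \<sigma> i(2-4)]
    show "CMap (bar_counit_cell \<sigma>) i x \<in> Val (pullback_sfun ?J (Tr (loose_id A'))) i"
      by (simp add: i(1) bar_counit_cell_def pullback_sfun_def prod_func_def star_func_def
          prof_id_def loose_id_def)
  next
    fix i x
    assume "i \<in> Arr ?I" "x \<in> Val (Tr (bar p)) (Dom ?I i)"
    then obtain f g where i: "i = (f, (), (), [g])"
      "f \<in> Hom A (Dom A f) (Cod A f)" "g \<in> Hom B (Dom B g) (Cod B g)"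
      "x \<in> Val p (Dom A f, Cod B g)"
      by (rule bar_arrE)
    from prof_cell_Act[OF \<sigma> i(2-4)]
    show "CMap (bar_counit_cell \<sigma>) (Cod ?I i) (Act (Tr (bar p)) i x) =
        Act (pullback_sfun ?J (Tr (loose_id A'))) i (CMap (bar_counit_cell \<sigma>) (Dom ?I i) x)"
      by (simp add: i(1) bar_counit_cell_def pullback_sfun_def prod_func_def star_func_def
          prof_id_def loose_id_def star_def)
  qed
  moreover have "is_functor A A' F" "is_functor B A' G"
    using \<sigma> by (simp_all add: is_prof_cell_def)
  ultimately show ?thesis
    using is_functor_id_func[of unit_cat]
    by (simp add: is_cell_def bar_counit_cell_def loose_id_def)
qed

section \<open>Representatives in composites of \<open>bar p\<close> with a loose identity\<close>

lemma Val_ext_singleton: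
  "y \<in> Val (ext A B T) ([a], q, q', c) \<longleftrightarrow> (\<exists>x. y = Letter x \<and> x \<in> Val (Tr T) (a, q, q', c))"
  by (auto simp: ext_def)

lemma Act_ext_Letter [simp]:
  "Act (ext A B T) ([f], g, h, \<beta>) (Letter x) = Letter (Act (Tr T) (f, g, h, \<beta>) x)"
  by (simp add: ext_def)

lemma Val_loose_id: "k \<in> Val (Tr (loose_id A)) (a, u, u', as) \<longleftrightarrow> k \<in> Hom (star A) as [a]"
  by (simp add: loose_id_def)

lemma Act_loose_id:
  "Act (Tr (loose_id A)) (f, u, u', [g]) [k] = [Cmp A f (Cmp A k g)]"
  by (simp add: loose_id_def star_def)

lemma Idt_star: "Idt (star C) xs = map (Idt C) xs"
  by (simp add: star_def)

lemma St_loose_id [simp]: "St (loose_id A) = unit_cat"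
  by (simp add: loose_id_def)

text \<open>The two list arguments are kept apart because generating pairs evaluate the integrand
  off the diagonal, at the codomain and the domain of an arrow of lists; these still have equal
  length. Then \<open>bar p\<close> forces \<open>bs\<close> to one letter, equal length does so for
  \<open>bs'\<close>, and the element of the loose identity does so for \<open>cs\<close>.\<close>

lemma comp_integrand_bar_loose_idE:
  assumes "(x, y) \<in> Val (comp_integrand A B B (bar p) (loose_id B) a (u, v) (u', v') cs) (bs, bs')"
    and "length bs = length bs'"
  obtains b b' c g where "bs = [b]" and "bs' = [b']" and "cs = [c]" and "y = Letter [g]"
    and "x \<in> Val p (a, b)" and "g \<in> Hom B c b'"
proof -
  have xy: "x \<in> Val (Tr (bar p)) (a, u, u', bs)" "y \<in> Val (ext B B (loose_id B)) (bs', v, v', cs)"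
    using assms(1) by (simp_all add: comp_integrand_def)
  obtain b where b: "bs = [b]" "x \<in> Val p (a, b)"
    using xy(1) by (auto simp: Val_bar)
  then obtain b' where b': "bs' = [b']"
    using assms(2) by (cases bs') auto
  then obtain k where k: "y = Letter k" "k \<in> Hom (star B) cs [b']"
    using xy(2) by (auto simp: Val_ext_singleton Val_loose_id)
  obtain c g where "cs = [c]" "k = [g]" "g \<in> Hom B c b'"
    using k(2) by (rule Hom_star_singletonE)
  then show thesis
    using that b b' k(1) by blast
qed

text \<open>The roles are exchanged: the arrow into \<open>[a]\<close> forces \<open>as\<close> to
  one letter, and \<open>bar p\<close>, now reached through \<open>ext\<close>, forces
  \<open>cs\<close>.\<close>

lemma comp_integrand_loose_id_barE:
  assumes "(k, y) \<in> Val (comp_integrand A A B (loose_id A) (bar p) a (u, v) (u', v') cs) (as, as')"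
    and "length as = length as'"
  obtains a1 a2 f c x where "as = [a1]" and "as' = [a2]" and "cs = [c]" and "k = [f]"
    and "y = Letter x" and "f \<in> Hom A a1 a" and "x \<in> Val p (a2, c)"
proof -
  have ky: "k \<in> Hom (star A) as [a]" "y \<in> Val (ext A B (bar p)) (as', v, v', cs)"
    using assms(1) by (simp_all add: comp_integrand_def Val_loose_id)
  obtain a1 f where f: "as = [a1]" "k = [f]" "f \<in> Hom A a1 a"
    using ky(1) by (rule Hom_star_singletonE)
  then obtain a2 where a2: "as' = [a2]"
    using assms(2) by (cases as') auto
  then show thesis
    using that f ky(2) by (auto simp: Val_ext_singleton Val_bar)
qed

lemma coend_step_starE:
  assumes "(z, z') \<in> coend_step (star C) P"
  obtains \<gamma> x where "\<gamma> \<in> lists (Arr C)" and "x \<in> Val P (map (Cod C) \<gamma>, map (Dom C) \<gamma>)"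
    and "z = (map (Dom C) \<gamma>, Act P (\<gamma>, map (Idt C) (map (Dom C) \<gamma>)) x)"
    and "z' = (map (Cod C) \<gamma>, Act P (map (Idt C) (map (Cod C) \<gamma>), \<gamma>) x)"
  using assms by (auto simp: coend_step_def star_def)

lemma respects_step_unitor_post:
  assumes A: "small_category A" and B: "small_category B" and p: "is_prof A B p"
    and a: "a \<in> Ob A"
  shows "respects_step (star B) (comp_integrand A B B (bar p) (loose_id B) a (u, v) (u', v') cs)
    (\<lambda>(bs, (x, y)). Act (Tr (bar p)) (Idt A a, w, w', loose_id_word B y) x)"
    (is "respects_step _ ?P ?\<phi>")
proof (rule respects_stepI)
  fix z z'
  assume "(z, z') \<in> coend_step (star B) ?P"
  then obtain \<gamma> e where \<gamma>: "\<gamma> \<in> lists (Arr B)" "e \<in> Val ?P (map (Cod B) \<gamma>, map (Dom B) \<gamma>)"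
    "z = (map (Dom B) \<gamma>, Act ?P (\<gamma>, map (Idt B) (map (Dom B) \<gamma>)) e)"
    "z' = (map (Cod B) \<gamma>, Act ?P (map (Idt B) (map (Cod B) \<gamma>), \<gamma>) e)"
    by (rule coend_step_starE)
  obtain x y where e: "e = (x, y)"
    by (cases e)
  obtain b b' c g where xy: "map (Cod B) \<gamma> = [b]" "map (Dom B) \<gamma> = [b']" "cs = [c]"
    "y = Letter [g]" "x \<in> Val p (a, b)" "g \<in> Hom B c b'"
    using \<gamma>(2) unfolding e by (rule comp_integrand_bar_loose_idE) simp
  obtain f where f: "\<gamma> = [f]" "f \<in> Hom B b' b"
    using xy(1,2) \<gamma>(1) by (auto simp: map_eq_Cons_conv Hom_def)
  have b: "b \<in> Ob B" "b' \<in> Ob B" "c \<in> Ob B"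
    using Hom_Ob[OF B] f(2) xy(6) by auto
  note Aa = Idt_Hom[OF A a]
  \<comment> \<open>Once \<open>loose_id_word\<close> has returned the arrow inside
    \<open>Letter\<close>, this is the co-Yoneda equation for \<open>p\<close> at the letter
    \<open>f\<close>.\<close>
  have "Act p (Idt A a, Cmp B (Idt B b') (Cmp B g (Idt B c))) (Act p (Idt A a, f) x)
      = Act p (Idt A a, Cmp B f (Cmp B g (Idt B c))) (Act p (Idt A a, Idt B b) x)"
    by (simp add: Cmp_Idt_right[OF B xy(6)] Cmp_Idt_left[OF B xy(6)]
        Act_prof_Idt[OF p a b(1) xy(5)] Act_prof_Cmp[OF p Aa Aa f(2) xy(6,5)]
        Cmp_Idt_left[OF A Aa])
  then show "?\<phi> z = ?\<phi> z'"
    using \<gamma>(3,4) f(2)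
    by (simp add: e f(1) xy(3,4) comp_integrand_def Idt_star Act_loose_id loose_id_word_def HomD)
qed

text \<open>The letter \<open>c\<close> occurs only as an index of a value of \<open>p\<close>, so
  its being an object is taken from \<open>cs\<close>; all other objects are endpoints of arrows at
  hand.\<close>

lemma respects_step_unitor_pre:
  assumes A: "small_category A" and B: "small_category B" and p: "is_prof A B p"
    and cs: "cs \<in> lists (Ob B)"
  shows "respects_step (star A) (comp_integrand A A B (loose_id A) (bar p) a (u, v) (u', v') cs)
    (\<lambda>(as, (k, y)). case Act (ext A B (bar p)) (k, w, w', Idt (star B) cs) y of Letter x \<Rightarrow> x)"
    (is "respects_step _ ?P ?\<phi>")
proof (rule respects_stepI)
  fix z z'
  assume "(z, z') \<in> coend_step (star A) ?P"
  then obtain \<gamma> e where \<gamma>: "\<gamma> \<in> lists (Arr A)" "e \<in> Val ?P (map (Cod A) \<gamma>, map (Dom A) \<gamma>)"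
    "z = (map (Dom A) \<gamma>, Act ?P (\<gamma>, map (Idt A) (map (Dom A) \<gamma>)) e)"
    "z' = (map (Cod A) \<gamma>, Act ?P (map (Idt A) (map (Cod A) \<gamma>), \<gamma>) e)"
    by (rule coend_step_starE)
  obtain k y where e: "e = (k, y)"
    by (cases e)
  obtain a1 a2 h c x where ky: "map (Cod A) \<gamma> = [a1]" "map (Dom A) \<gamma> = [a2]" "cs = [c]"
    "k = [h]" "y = Letter x" "h \<in> Hom A a1 a" "x \<in> Val p (a2, c)"
    using \<gamma>(2) unfolding e by (rule comp_integrand_loose_id_barE) simp
  obtain f where f: "\<gamma> = [f]" "f \<in> Hom A a2 a1"
    using ky(1,2) \<gamma>(1) by (auto simp: map_eq_Cons_conv Hom_def)
  have a: "a \<in> Ob A" "a1 \<in> Ob A" "a2 \<in> Ob A" and c: "c \<in> Ob B"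
    using Hom_Ob[OF A] f(2) ky(3,6) cs by auto
  note Bc = Idt_Hom[OF B c]
  have hf: "Cmp A h f \<in> Hom A a2 a"
    using Cmp_Hom[OF A f(2) ky(6)] .
  have "Act p (Cmp A (Idt A a) (Cmp A h f), Idt B c) (Act p (Idt A a2, Idt B c) x)
      = Act p (Cmp A (Idt A a) (Cmp A h (Idt A a1)), Idt B c) (Act p (f, Idt B c) x)"
    by (simp add: Cmp_Idt_left[OF A hf] Cmp_Idt_right[OF A ky(6)] Cmp_Idt_left[OF A ky(6)]
        Act_prof_Idt[OF p a(3) c ky(7)] Act_prof_Cmp[OF p f(2) ky(6) Bc Bc ky(7)]
        Cmp_Idt_left[OF B Bc])
  then show "?\<phi> z = ?\<phi> z'"
    using \<gamma>(3,4) f(2)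
    by (simp add: e f(1) ky(3,4,5) comp_integrand_def Idt_star Act_loose_id HomD)
qed


section \<open>Companions\<close>

text \<open>The companion and conjoint equations on representatives of coend classes. Neither
  mentions a coend, so they can be transported along \<^const>\<open>bar\<close>.\<close>

definition companion_cells ::
    "('a, 'f) cat \<Rightarrow> ('b, 'g) cat \<Rightarrow> ('a, 'f, 'b, 'g) func \<Rightarrow> ('a, 'f, 'b, 'g, 'e) prof
      \<Rightarrow> ('a \<times> 'a \<Rightarrow> 'f \<Rightarrow> 'e) \<Rightarrow> ('a \<times> 'b \<Rightarrow> 'e \<Rightarrow> 'g) \<Rightarrow> bool" where
  "companion_cells A B F p \<eta> \<epsilon> \<longleftrightarrow>
     is_prof_cell A A A B (id_func A) F (prof_id A) p \<eta> \<and>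
     is_prof_cell A B B B F (id_func B) p (prof_id B) \<epsilon> \<and>
     (\<forall>a a' f. f \<in> Hom A a' a \<longrightarrow> \<epsilon> (a, Fob F a') (\<eta> (a, a') f) = Far F f) \<and>
     (\<forall>a a' b f x. f \<in> Hom A a' a \<longrightarrow> b \<in> Ob B \<longrightarrow> x \<in> Val p (a', b) \<longrightarrow>
        Act p (Idt A a, \<epsilon> (a', b) x) (\<eta> (a, a') f) = Act p (f, Idt B b) x)"

definition conjoint_cells ::
    "('a, 'f) cat \<Rightarrow> ('b, 'g) cat \<Rightarrow> ('a, 'f, 'b, 'g) func \<Rightarrow> ('b, 'g, 'a, 'f, 'e) prof
      \<Rightarrow> ('b \<times> 'a \<Rightarrow> 'e \<Rightarrow> 'g) \<Rightarrow> ('a \<times> 'a \<Rightarrow> 'f \<Rightarrow> 'e) \<Rightarrow> bool" where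
  "conjoint_cells A B F p \<epsilon> \<eta> \<longleftrightarrow>
     is_prof_cell B A B B (id_func B) F p (prof_id B) \<epsilon> \<and>
     is_prof_cell A A B A F (id_func A) (prof_id A) p \<eta> \<and>
     (\<forall>a a' f. f \<in> Hom A a' a \<longrightarrow> \<epsilon> (Fob F a, a') (\<eta> (a, a') f) = Far F f) \<and>
     (\<forall>a a' b f x. f \<in> Hom A a' a \<longrightarrow> b \<in> Ob B \<longrightarrow> x \<in> Val p (b, a) \<longrightarrow>
        Act p (\<epsilon> (b, a) x, Idt A a') (\<eta> (a, a') f) = Act p (Idt B b, f) x)"

lemma is_prof_companionI:
  assumes A: "small_category A" and B: "small_category B" and p: "is_prof A B p"
    and cells: "companion_cells A B F p \<eta> \<epsilon>"
  shows "is_prof_companion A B F p"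
proof -
  have \<eta>: "is_prof_cell A A A B (id_func A) F (prof_id A) p \<eta>"
    and \<epsilon>: "is_prof_cell A B B B F (id_func B) p (prof_id B) \<epsilon>"
    and vert: "\<And>a a' f. f \<in> Hom A a' a \<Longrightarrow> \<epsilon> (a, Fob F a') (\<eta> (a, a') f) = Far F f"
    and horiz: "\<And>a a' b f x. f \<in> Hom A a' a \<Longrightarrow> b \<in> Ob B \<Longrightarrow> x \<in> Val p (a', b) \<Longrightarrow>
        Act p (Idt A a, \<epsilon> (a', b) x) (\<eta> (a, a') f) = Act p (f, Idt B b) x"
    using cells by (simp_all add: companion_cells_def)
  have F: "is_functor A B F"
    using \<epsilon> by (simp add: is_prof_cell_def)
  let ?\<phi> = "\<lambda>b (_, (f, x)). Act p (f, Idt B b) x"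
  let ?\<psi> = "\<lambda>a (_, (x, g)). Act p (Idt A a, g) x"
  \<comment> \<open>The horizontal composite on representatives. The middle object moves along
    \<open>F\<close>, the inner boundary shared by \<eta> and \<epsilon>.\<close>
  let ?\<theta> = "\<lambda>a b (a', (f, x)). (Fob F a', (\<eta> (a, a') f, \<epsilon> (a', b) x))"
  have "coend_desc (?\<psi> a)
      (coend_map B (prof_comp_integrand A B p (prof_id B) a b)
        (?\<theta> a b) X)
      = coend_desc (?\<phi> b) X"
    if a: "a \<in> Ob A" and b: "b \<in> Ob B"
      and X: "X \<in> coend A (prof_comp_integrand A B (prof_id A) p a b)" for a b X
  proof (rule coend_desc_coend_map[OF X respects_step_prof_unitor_pre[OF A B p a b]
        respects_step_prof_unitor_post[OF A B p a b]])
    fix z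
    assume z: "z \<in> coend_carrier A (prof_comp_integrand A B (prof_id A) p a b)"
    obtain a' f x where zz: "z = (a', f, x)"
      by (cases z)
    have a': "a' \<in> Ob A" and f: "f \<in> Hom A a' a" and x: "x \<in> Val p (a', b)"
      using z by (auto simp: zz coend_carrier_def prof_comp_integrand_def prof_id_def)
    have "\<eta> (a, a') f \<in> Val p (a, Fob F a')"
      using prof_cell_Val[OF \<eta> a a', of f] f by (simp add: prof_id_def id_func_def)
    moreover have "\<epsilon> (a', b) x \<in> Hom B b (Fob F a')"
      using prof_cell_Val[OF \<epsilon> a' b x] by (simp add: prof_id_def id_func_def)
    ultimately show "?\<theta> a b z \<in> coend_carrier B (prof_comp_integrand A B p (prof_id B) a b) \<and>
        ?\<psi> a (?\<theta> a b z) = ?\<phi> b z"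
      using Fob_Ob[OF F a'] horiz[OF f b x]
      by (simp add: zz coend_carrier_def prof_comp_integrand_def prof_id_def)
  qed
  then have "prof_cell_eq A B (prof_comp A A B (prof_id A) p)
      (prof_vcomp (id_func A) (id_func B)
         (prof_hcomp A B B (id_func A) F (id_func B) p (prof_id B) \<eta> \<epsilon>) (prof_unitor_post A p))
      (prof_vcomp (id_func A) (id_func B) (prof_unitor_pre B p) (\<lambda>_ e. e))"
    by (simp add: prof_cell_eq_def prof_comp_def prof_vcomp_def prof_hcomp_def prod_cat_def
        op_cat_def prof_unitor_post_def prof_unitor_pre_def prod_func_def id_func_def)
  moreover have "prof_cell_eq A A (prof_id A) (prof_vcomp (id_func A) F \<eta> \<epsilon>) (\<lambda>_. Far F)"
    by (simp add: prof_cell_eq_def prof_vcomp_def prod_func_def id_func_def prof_id_def vert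
        prod_cat_def)
  ultimately show ?thesis
    using p \<eta> \<epsilon> unfolding is_prof_companion_def by blast
qed

text \<open>On letters the cells of \<open>bar p\<close> compute to \<eta> and \<epsilon>, so
  \<open>horiz\<close> again provides the pointwise equation between the unitors, now over coends
  indexed by lists.\<close>

lemma is_companion_barI:
  assumes A: "small_category A" and B: "small_category B" and p: "is_prof A B p"
    and cells: "companion_cells A B F p \<eta> \<epsilon>"
  shows "is_companion A B F (bar p)"
proof -
  have \<eta>: "is_prof_cell A A A B (id_func A) F (prof_id A) p \<eta>"
    and \<epsilon>: "is_prof_cell A B B B F (id_func B) p (prof_id B) \<epsilon>"
    and vert: "\<And>a a' f. f \<in> Hom A a' a \<Longrightarrow> \<epsilon> (a, Fob F a') (\<eta> (a, a') f) = Far F f"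
    and horiz: "\<And>a a' b f x. f \<in> Hom A a' a \<Longrightarrow> b \<in> Ob B \<Longrightarrow> x \<in> Val p (a', b) \<Longrightarrow>
        Act p (Idt A a, \<epsilon> (a', b) x) (\<eta> (a, a') f) = Act p (f, Idt B b) x"
    using cells by (simp_all add: companion_cells_def)
  have F: "is_functor A B F"
    using \<epsilon> by (simp add: is_prof_cell_def)
  let ?P = "\<lambda>a cs. comp_integrand A A B (loose_id A) (bar p) a ((), ()) ((), ()) cs"
  let ?Q = "\<lambda>a cs. comp_integrand A B B (bar p) (loose_id B) a ((), ()) ((), ()) cs"
  let ?u = "Idt unit_cat ()"
  let ?\<psi> = "\<lambda>a (bs, (x, y)). Act (Tr (bar p)) (Idt A a, ?u, ?u, loose_id_word B y) x"
  let ?\<phi> = "\<lambda>cs (as, (k, y)).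
    case Act (ext A B (bar p)) (k, ?u, ?u, Idt (star B) cs) y of Letter x \<Rightarrow> x"
  let ?\<theta> = "\<lambda>a cs (as, (k, y)). (map (Fob F) as,
    (CMap (bar_unit_cell \<eta>) (a, (), (), as) k,
     ext_cell B B F (id_func B) (loose_id B) (bar_counit_cell \<epsilon>) (as, (), (), cs) y))"
  have main: "coend_desc (?\<psi> a) (coend_map (star B) (?Q a cs) (?\<theta> a cs) X) = coend_desc (?\<phi> cs) X"
    if a: "a \<in> Ob A" and cs: "cs \<in> lists (Ob B)" and X: "X \<in> coend (star A) (?P a cs)" for a cs X
  proof (rule coend_desc_coend_map[OF X respects_step_unitor_pre[OF A B p cs]
        respects_step_unitor_post[OF A B p a]])
    fix z
    assume z: "z \<in> coend_carrier (star A) (?P a cs)"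
    obtain as k y where zz: "z = (as, (k, y))"
      by (cases z)
    have as: "as \<in> lists (Ob A)" and ky: "(k, y) \<in> Val (?P a cs) (as, as)"
      using z by (auto simp: zz coend_carrier_def star_def)
    \<comment> \<open>A representative lies on the diagonal, so \<open>a'\<close> and
      \<open>a2\<close> are the same letter.\<close>
    obtain a' a2 f b x where ky: "as = [a']" "as = [a2]" "cs = [b]" "k = [f]" "y = Letter x"
      "f \<in> Hom A a' a" "x \<in> Val p (a2, b)"
      using ky by (rule comp_integrand_loose_id_barE) simp
    then have x: "x \<in> Val p (a', b)" and a': "a' \<in> Ob A" and b: "b \<in> Ob B"
      using as cs by auto
    have "\<eta> (a, a') f \<in> Val p (a, Fob F a')"
      using prof_cell_Val[OF \<eta> a a', of f] ky(6) by (simp add: prof_id_def id_func_def)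
    moreover have "\<epsilon> (a', b) x \<in> Hom B b (Fob F a')"
      using prof_cell_Val[OF \<epsilon> a' b x] by (simp add: prof_id_def id_func_def)
    ultimately show "?\<theta> a cs z \<in> coend_carrier (star B) (?Q a cs) \<and> ?\<psi> a (?\<theta> a cs z) = ?\<phi> cs z"
      using Fob_Ob[OF F a'] horiz[OF ky(6) b x]
      \<comment> \<open>Unfolding \<open>star B\<close> also exposes the record inside
        \<open>Hom\<close>, hence the singleton rule is supplied in unfolded form.\<close>
      by (simp add: zz ky(1,3-5) coend_carrier_def comp_integrand_def Val_bar Val_loose_id
          Val_ext_singleton ext_cell_def bar_unit_cell_def bar_counit_cell_def star_def[of B]
          loose_id_word_def Idt_star Hom_star_singleton_iff[unfolded star_def])
  qed
  \<comment> \<open>On states the equation compares the two projections from the product of the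
    terminal category with itself, which agree.\<close>
  have "cell_eq A B (loose_comp A A B (loose_id A) (bar p))
      (vcomp (id_func A) (id_func B)
         (hcomp A B B (id_func A) F (id_func B) (bar p) (loose_id B)
           (bar_unit_cell \<eta>) (bar_counit_cell \<epsilon>)) (unitor_post A B (bar p)))
      (vcomp (id_func A) (id_func B) (unitor_pre A B (bar p)) (id_cell (bar p)))"
    using main
    by (simp add: cell_eq_def functor_eq_def vcomp_def hcomp_def comp_func_def unitor_post_def
        unitor_pre_def id_cell_def loose_comp_def td_index_def prod_cat_def op_cat_def
        prod_func_def star_func_def id_func_def fst_func_def snd_func_def star_def[of B])
  moreover have "cell_eq A A (loose_id A)
      (vcomp (id_func A) F (bar_unit_cell \<eta>) (bar_counit_cell \<epsilon>)) (tight_id_cell F)"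
    unfolding cell_eq_def
  proof (intro conjI ballI)
    show "functor_eq (St (loose_id A))
        (CSt (vcomp (id_func A) F (bar_unit_cell \<eta>) (bar_counit_cell \<epsilon>))) (CSt (tight_id_cell F))"
      by (simp add: functor_eq_def)
  next
    fix i k
    assume "i \<in> Ob (td_index A (St (loose_id A)) A)" "k \<in> Val (Tr (loose_id A)) i"
    then show "CMap (vcomp (id_func A) F (bar_unit_cell \<eta>) (bar_counit_cell \<epsilon>)) i k =
        CMap (tight_id_cell F) i k"
      unfolding St_loose_id
      by (rule loose_id_obE)
        (simp add: vcomp_def bar_unit_cell_def bar_counit_cell_def tight_id_cell_def
          prod_func_def star_func_def id_func_def vert)
  qed
  ultimately show ?thesis
    using is_transducer_bar[OF p] is_cell_bar_unit_cell[OF \<eta>] is_cell_bar_counit_cell[OF \<epsilon>]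
    unfolding is_companion_def by blast
qed

section \<open>The representable profunctor B(b, F a)\<close>

lemma Far_Cmp3:
  assumes "small_category C" "is_functor C D F" "f \<in> Hom C x y" "g \<in> Hom C y z" "h \<in> Hom C z w"
  shows "Far F (Cmp C h (Cmp C g f)) = Cmp D (Far F h) (Cmp D (Far F g) (Far F f))"
  using Far_Cmp[OF assms(2) Cmp_Hom[OF assms(1,3,4)] assms(5)] Far_Cmp[OF assms(2-4)] by simp

lemma is_prof_prof_companion:
  assumes B: "small_category B" and F: "is_functor A B F"
  shows "is_prof A B (prof_companion B F)"
proof (rule is_profI)
  fix a a' b b' f g x
  assume "f \<in> Hom A a a'" "g \<in> Hom B b' b" "x \<in> Val (prof_companion B F) (a, b)"
  then show "Act (prof_companion B F) (f, g) x \<in> Val (prof_companion B F) (a', b')"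
    using Cmp_Hom[OF B Cmp_Hom[OF B]] Far_Hom[OF F] by (simp add: prof_companion_def)
next
  fix a b x
  assume "a \<in> Ob A" "b \<in> Ob B" "x \<in> Val (prof_companion B F) (a, b)"
  then show "Act (prof_companion B F) (Idt A a, Idt B b) x = x"
    by (simp add: prof_companion_def Far_Idt[OF F] Cmp_Idt_left[OF B] Cmp_Idt_right[OF B])
next
  fix a a' a'' b b' b'' f f' g g' x
  assume h: "f \<in> Hom A a a'" "f' \<in> Hom A a' a''" "g \<in> Hom B b' b" "g' \<in> Hom B b'' b'"
    "x \<in> Val (prof_companion B F) (a, b)"
  then have x: "x \<in> Hom B b (Fob F a)"
    by (simp add: prof_companion_def)
  note Ff = Far_Hom[OF F h(1)] and Ff' = Far_Hom[OF F h(2)]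
  note xg = Cmp_Hom[OF B h(3) x]
  show "Act (prof_companion B F) (f', g') (Act (prof_companion B F) (f, g) x) =
      Act (prof_companion B F) (Cmp A f' f, Cmp B g g') x"
    \<comment> \<open>Associativity is given at fixed arrows, as it is used in both directions; the
      common normal form is (F f' o F f) o ((x o g) o g').\<close>
    by (simp add: prof_companion_def Far_Cmp[OF F h(1,2)] Cmp_assoc[OF B h(4,3) x]
        Cmp_assoc[OF B h(4) xg Ff, symmetric]
        Cmp_assoc[OF B Cmp_Hom[OF B h(4) xg] Ff Ff'])
qed

lemma companion_cells_prof_companion:
  assumes A: "small_category A" and B: "small_category B" and F: "is_functor A B F"
  shows "companion_cells A B F (prof_companion B F) (\<lambda>_. Far F) (\<lambda>_ x. x)"
proof -
  have "is_prof_cell A A A B (id_func A) F (prof_id A) (prof_companion B F) (\<lambda>_. Far F)"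
    by (rule is_prof_cellI)
      (simp_all add: is_functor_id_func[unfolded id_func_def] F prof_id_def
        prof_companion_def id_func_def
        Far_Hom[OF F] Far_Cmp3[OF A F])
  moreover have "is_prof_cell A B B B F (id_func B) (prof_companion B F) (prof_id B) (\<lambda>_ x. x)"
    by (rule is_prof_cellI)
      (simp_all add: is_functor_id_func[unfolded id_func_def] F prof_id_def
        prof_companion_def id_func_def)
  \<comment> \<open>The horizontal equation: \<open>(Idt A a, x)\<close> acting on F f against
    \<open>(f, Idt B b)\<close> acting on x. Both give F f o x.\<close>
  moreover have "Cmp B (Far F (Idt A a)) (Cmp B (Far F f) x) =
      Cmp B (Far F f) (Cmp B x (Idt B b))"
    if f: "f \<in> Hom A a' a" and x: "x \<in> Hom B b (Fob F a')" for a a' b f x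
    using Hom_Ob[OF A f] Cmp_Idt_left[OF B Cmp_Hom[OF B x Far_Hom[OF F f]]]
    by (simp add: Far_Idt[OF F] Cmp_Idt_right[OF B x])
  ultimately show ?thesis
    by (simp add: companion_cells_def prof_companion_def)
qed


section \<open>Conjoints\<close>

text \<open>The unitors trade places. Now \<epsilon> acts on the left factor, so representatives
  start in \<open>p\<close> followed by the hom profunctor of \<open>A\<close>, evaluated by the
  post-unitor, and end in the hom profunctor of \<open>B\<close> followed by \<open>p\<close>,
  evaluated by the pre-unitor.\<close>

lemma is_prof_conjointI:
  assumes A: "small_category A" and B: "small_category B" and p: "is_prof B A p"
    and cells: "conjoint_cells A B F p \<epsilon> \<eta>"
  shows "is_prof_conjoint A B F p"
proof -
  have \<epsilon>: "is_prof_cell B A B B (id_func B) F p (prof_id B) \<epsilon>"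
    and \<eta>: "is_prof_cell A A B A F (id_func A) (prof_id A) p \<eta>"
    and vert: "\<And>a a' f. f \<in> Hom A a' a \<Longrightarrow> \<epsilon> (Fob F a, a') (\<eta> (a, a') f) = Far F f"
    and horiz: "\<And>a a' b f x. f \<in> Hom A a' a \<Longrightarrow> b \<in> Ob B \<Longrightarrow> x \<in> Val p (b, a) \<Longrightarrow>
        Act p (\<epsilon> (b, a) x, Idt A a') (\<eta> (a, a') f) = Act p (Idt B b, f) x"
    using cells by (simp_all add: conjoint_cells_def)
  have F: "is_functor A B F"
    using \<epsilon> by (simp add: is_prof_cell_def)
  let ?\<phi> = "\<lambda>b (_, (x, f)). Act p (Idt B b, f) x"
  let ?\<psi> = "\<lambda>a' (_, (f, y)). Act p (f, Idt A a') y"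
  let ?\<theta> = "\<lambda>b a' (a, (x, f)). (Fob F a, (\<epsilon> (b, a) x, \<eta> (a, a') f))"
  have "coend_desc (?\<psi> a')
      (coend_map B (prof_comp_integrand B A (prof_id B) p b a')
        (?\<theta> b a') X)
      = coend_desc (?\<phi> b) X"
    if b: "b \<in> Ob B" and a': "a' \<in> Ob A"
      and X: "X \<in> coend A (prof_comp_integrand B A p (prof_id A) b a')" for b a' X
  proof (rule coend_desc_coend_map[OF X respects_step_prof_unitor_post[OF B A p b a']
        respects_step_prof_unitor_pre[OF B A p b a']])
    fix z
    assume z: "z \<in> coend_carrier A (prof_comp_integrand B A p (prof_id A) b a')"
    obtain a x f where zz: "z = (a, x, f)"
      by (cases z)
    have a: "a \<in> Ob A" and f: "f \<in> Hom A a' a" and x: "x \<in> Val p (b, a)"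
      using z by (auto simp: zz coend_carrier_def prof_comp_integrand_def prof_id_def)
    have "\<eta> (a, a') f \<in> Val p (Fob F a, a')"
      using prof_cell_Val[OF \<eta> a a', of f] f by (simp add: prof_id_def id_func_def)
    moreover have "\<epsilon> (b, a) x \<in> Hom B (Fob F a) b"
      using prof_cell_Val[OF \<epsilon> b a x] by (simp add: prof_id_def id_func_def)
    ultimately show "?\<theta> b a' z \<in> coend_carrier B (prof_comp_integrand B A (prof_id B) p b a') \<and>
        ?\<psi> a' (?\<theta> b a' z) = ?\<phi> b z"
      using Fob_Ob[OF F a] horiz[OF f b x]
      by (simp add: zz coend_carrier_def prof_comp_integrand_def prof_id_def)
  qed
  then have "prof_cell_eq B A (prof_comp B A A p (prof_id A))
      (prof_vcomp (id_func B) (id_func A)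
         (prof_hcomp B B A (id_func B) F (id_func A) (prof_id B) p \<epsilon> \<eta>) (prof_unitor_pre A p))
      (prof_vcomp (id_func B) (id_func A) (prof_unitor_post B p) (\<lambda>_ e. e))"
    by (simp add: prof_cell_eq_def prof_comp_def prof_vcomp_def prof_hcomp_def prod_cat_def
        op_cat_def prof_unitor_post_def prof_unitor_pre_def prod_func_def id_func_def)
  moreover have "prof_cell_eq A A (prof_id A) (prof_vcomp F (id_func A) \<eta> \<epsilon>) (\<lambda>_. Far F)"
    by (simp add: prof_cell_eq_def prof_vcomp_def prod_func_def id_func_def prof_id_def vert
        prod_cat_def)
  ultimately show ?thesis
    using p \<eta> \<epsilon> unfolding is_prof_conjoint_def by blast
qed

lemma is_conjoint_barI:
  assumes A: "small_category A" and B: "small_category B" and p: "is_prof B A p"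
    and cells: "conjoint_cells A B F p \<epsilon> \<eta>"
  shows "is_conjoint A B F (bar p)"
proof -
  have \<epsilon>: "is_prof_cell B A B B (id_func B) F p (prof_id B) \<epsilon>"
    and \<eta>: "is_prof_cell A A B A F (id_func A) (prof_id A) p \<eta>"
    and vert: "\<And>a a' f. f \<in> Hom A a' a \<Longrightarrow> \<epsilon> (Fob F a, a') (\<eta> (a, a') f) = Far F f"
    and horiz: "\<And>a a' b f x. f \<in> Hom A a' a \<Longrightarrow> b \<in> Ob B \<Longrightarrow> x \<in> Val p (b, a) \<Longrightarrow>
        Act p (\<epsilon> (b, a) x, Idt A a') (\<eta> (a, a') f) = Act p (Idt B b, f) x"
    using cells by (simp_all add: conjoint_cells_def)
  have F: "is_functor A B F"
    using \<epsilon> by (simp add: is_prof_cell_def)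
  let ?P = "\<lambda>b cs. comp_integrand B A A (bar p) (loose_id A) b ((), ()) ((), ()) cs"
  let ?Q = "\<lambda>b cs. comp_integrand B B A (loose_id B) (bar p) b ((), ()) ((), ()) cs"
  let ?u = "Idt unit_cat ()"
  let ?\<phi> = "\<lambda>b (as, (x, y)). Act (Tr (bar p)) (Idt B b, ?u, ?u, loose_id_word A y) x"
  let ?\<psi> = "\<lambda>cs (bs, (k, y)).
    case Act (ext B A (bar p)) (k, ?u, ?u, Idt (star A) cs) y of Letter x \<Rightarrow> x"
  let ?\<theta> = "\<lambda>b cs (as, (x, y)). (map (Fob F) as,
    (CMap (bar_counit_cell \<epsilon>) (b, (), (), as) x,
     ext_cell B A F (id_func A) (bar p) (bar_unit_cell \<eta>) (as, (), (), cs) y))"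
  have main: "coend_desc (?\<psi> cs) (coend_map (star B) (?Q b cs) (?\<theta> b cs) X) = coend_desc (?\<phi> b) X"
    if b: "b \<in> Ob B" and cs: "cs \<in> lists (Ob A)" and X: "X \<in> coend (star A) (?P b cs)" for b cs X
  proof (rule coend_desc_coend_map[OF X respects_step_unitor_post[OF B A p b]
        respects_step_unitor_pre[OF B A p cs]])
    fix z
    assume z: "z \<in> coend_carrier (star A) (?P b cs)"
    obtain as x y where zz: "z = (as, (x, y))"
      by (cases z)
    have as: "as \<in> lists (Ob A)" and xy: "(x, y) \<in> Val (?P b cs) (as, as)"
      using z by (auto simp: zz coend_carrier_def star_def)
    obtain a a2 a' f where xy: "as = [a]" "as = [a2]" "cs = [a']" "y = Letter [f]"
      "x \<in> Val p (b, a)" "f \<in> Hom A a' a2"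
      using xy by (rule comp_integrand_bar_loose_idE) simp
    then have f: "f \<in> Hom A a' a" and a: "a \<in> Ob A" and a': "a' \<in> Ob A"
      using as cs by auto
    have "\<eta> (a, a') f \<in> Val p (Fob F a, a')"
      using prof_cell_Val[OF \<eta> a a', of f] f by (simp add: prof_id_def id_func_def)
    moreover have "\<epsilon> (b, a) x \<in> Hom B (Fob F a) b"
      using prof_cell_Val[OF \<epsilon> b a xy(5)] by (simp add: prof_id_def id_func_def)
    ultimately show "?\<theta> b cs z \<in> coend_carrier (star B) (?Q b cs) \<and> ?\<psi> cs (?\<theta> b cs z) = ?\<phi> b z"
      using Fob_Ob[OF F a] horiz[OF f b xy(5)]
      by (simp add: zz xy(1,3,4) coend_carrier_def comp_integrand_def Val_bar Val_loose_id
          Val_ext_singleton ext_cell_def bar_unit_cell_def bar_counit_cell_def star_def[of B]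
          loose_id_word_def Idt_star Hom_star_singleton_iff[unfolded star_def])
  qed
  have "cell_eq B A (loose_comp B A A (bar p) (loose_id A))
      (vcomp (id_func B) (id_func A)
         (hcomp B B A (id_func B) F (id_func A) (loose_id B) (bar p)
           (bar_counit_cell \<epsilon>) (bar_unit_cell \<eta>)) (unitor_pre B A (bar p)))
      (vcomp (id_func B) (id_func A) (unitor_post B A (bar p)) (id_cell (bar p)))"
    using main
    by (simp add: cell_eq_def functor_eq_def vcomp_def hcomp_def comp_func_def unitor_post_def
        unitor_pre_def id_cell_def loose_comp_def td_index_def prod_cat_def op_cat_def
        prod_func_def star_func_def id_func_def fst_func_def snd_func_def star_def[of A])
  moreover have "cell_eq A A (loose_id A)
      (vcomp F (id_func A) (bar_unit_cell \<eta>) (bar_counit_cell \<epsilon>)) (tight_id_cell F)"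
    unfolding cell_eq_def
  proof (intro conjI ballI)
    show "functor_eq (St (loose_id A))
        (CSt (vcomp F (id_func A) (bar_unit_cell \<eta>) (bar_counit_cell \<epsilon>))) (CSt (tight_id_cell F))"
      by (simp add: functor_eq_def)
  next
    fix i k
    assume "i \<in> Ob (td_index A (St (loose_id A)) A)" "k \<in> Val (Tr (loose_id A)) i"
    then show "CMap (vcomp F (id_func A) (bar_unit_cell \<eta>) (bar_counit_cell \<epsilon>)) i k =
        CMap (tight_id_cell F) i k"
      unfolding St_loose_id
      by (rule loose_id_obE)
        (simp add: vcomp_def bar_unit_cell_def bar_counit_cell_def tight_id_cell_def
          prod_func_def star_func_def id_func_def vert)
  qed
  ultimately show ?thesis
    using is_transducer_bar[OF p] is_cell_bar_unit_cell[OF \<eta>] is_cell_bar_counit_cell[OF \<epsilon>]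
    unfolding is_conjoint_def by blast
qed

section \<open>The representable profunctor B(F a, b)\<close>

lemma is_prof_prof_conjoint:
  assumes B: "small_category B" and F: "is_functor A B F"
  shows "is_prof B A (prof_conjoint B F)"
proof (rule is_profI)
  fix b b' a a' g f x
  assume "g \<in> Hom B b b'" "f \<in> Hom A a' a" "x \<in> Val (prof_conjoint B F) (b, a)"
  then show "Act (prof_conjoint B F) (g, f) x \<in> Val (prof_conjoint B F) (b', a')"
    using Cmp_Hom[OF B Cmp_Hom[OF B Far_Hom[OF F]]] by (simp add: prof_conjoint_def)
next
  fix b a x
  assume "b \<in> Ob B" "a \<in> Ob A" "x \<in> Val (prof_conjoint B F) (b, a)"
  then show "Act (prof_conjoint B F) (Idt B b, Idt A a) x = x"
    by (simp add: prof_conjoint_def Far_Idt[OF F] Cmp_Idt_left[OF B] Cmp_Idt_right[OF B])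
next
  fix b b' b'' a a' a'' g g' f f' x
  assume h: "g \<in> Hom B b b'" "g' \<in> Hom B b' b''" "f \<in> Hom A a' a" "f' \<in> Hom A a'' a'"
    "x \<in> Val (prof_conjoint B F) (b, a)"
  then have x: "x \<in> Hom B (Fob F a) b"
    by (simp add: prof_conjoint_def)
  note Ff = Far_Hom[OF F h(3)] and Ff' = Far_Hom[OF F h(4)]
  note xf = Cmp_Hom[OF B Ff x]
  show "Act (prof_conjoint B F) (g', f') (Act (prof_conjoint B F) (g, f) x) =
      Act (prof_conjoint B F) (Cmp B g' g, Cmp A f f') x"
    by (simp add: prof_conjoint_def Far_Cmp[OF F h(4,3)] Cmp_assoc[OF B Ff' Ff x]
        Cmp_assoc[OF B Ff' xf h(1), symmetric]
        Cmp_assoc[OF B Cmp_Hom[OF B Ff' xf] h(1,2)])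
qed

lemma conjoint_cells_prof_conjoint:
  assumes A: "small_category A" and B: "small_category B" and F: "is_functor A B F"
  shows "conjoint_cells A B F (prof_conjoint B F) (\<lambda>_ x. x) (\<lambda>_. Far F)"
proof -
  have "is_prof_cell B A B B (id_func B) F (prof_conjoint B F) (prof_id B) (\<lambda>_ x. x)"
    by (rule is_prof_cellI)
      (simp_all add: is_functor_id_func[unfolded id_func_def] F prof_id_def
        prof_conjoint_def id_func_def)
  moreover have "is_prof_cell A A B A F (id_func A) (prof_id A) (prof_conjoint B F) (\<lambda>_. Far F)"
    by (rule is_prof_cellI)
      (simp_all add: is_functor_id_func[unfolded id_func_def] F prof_id_def
        prof_conjoint_def id_func_def
        Far_Hom[OF F] Far_Cmp3[OF A F])
  \<comment> \<open>Here x acts covariantly on F f, and f contravariantly on x; both give x o F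
    f.\<close>
  moreover have "Cmp B x (Cmp B (Far F f) (Far F (Idt A a'))) =
      Cmp B (Idt B b) (Cmp B x (Far F f))"
    if f: "f \<in> Hom A a' a" and x: "x \<in> Hom B (Fob F a) b" for a a' b f x
    using Hom_Ob[OF A f] Cmp_Idt_left[OF B Cmp_Hom[OF B Far_Hom[OF F f] x]]
    by (simp add: Far_Idt[OF F] Cmp_Idt_right[OF B Far_Hom[OF F f]])
  ultimately show ?thesis
    by (simp add: conjoint_cells_def prof_conjoint_def)
qed

theorem mainTheorem13:
  fixes A :: "('a, 'f) cat" and B :: "('b, 'g) cat" and F :: "('a, 'f, 'b, 'g) func"
  assumes "small_category A" and "small_category B" and "is_functor A B F"
  shows "is_prof_companion A B F (prof_companion B F)
       \<and> is_prof_conjoint A B F (prof_conjoint B F)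
       \<and> is_companion A B F (bar (prof_companion B F))
       \<and> is_conjoint A B F (bar (prof_conjoint B F))
       \<and> St (bar (prof_companion B F)) = unit_cat
       \<and> St (bar (prof_conjoint B F)) = unit_cat
       \<and> (\<forall>a\<in>Ob A. \<forall>bs\<in>Ob (star B).
            (\<forall>b. bs = [b] \<longrightarrow>
               Val (Tr (bar (prof_companion B F))) (a, (), (), bs) = Hom B b (Fob F a)) \<and>
            (length bs \<noteq> 1 \<longrightarrow> Val (Tr (bar (prof_companion B F))) (a, (), (), bs) = {}))
       \<and> (\<forall>b\<in>Ob B. \<forall>as\<in>Ob (star A).
            (\<forall>a. as = [a] \<longrightarrow>
               Val (Tr (bar (prof_conjoint B F))) (b, (), (), as) = Hom B (Fob F a) b) \<and>
            (length as \<noteq> 1 \<longrightarrow> Val (Tr (bar (prof_conjoint B F))) (b, (), (), as) = {}))"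
proof -
  note AB = assms(1,2)
  note p = is_prof_prof_companion[OF assms(2,3)] and q = is_prof_prof_conjoint[OF assms(2,3)]
  note pc = companion_cells_prof_companion[OF assms]
    and qc = conjoint_cells_prof_conjoint[OF assms]
  have "is_prof_companion A B F (prof_companion B F)"
    using is_prof_companionI[OF AB p pc] .
  moreover have "is_prof_conjoint A B F (prof_conjoint B F)"
    using is_prof_conjointI[OF AB q qc] .
  moreover have "is_companion A B F (bar (prof_companion B F))"
    using is_companion_barI[OF AB p pc] .
  moreover have "is_conjoint A B F (bar (prof_conjoint B F))"
    using is_conjoint_barI[OF AB q qc] .
  ultimately show ?thesis
    by (auto simp: Val_bar prof_companion_def prof_conjoint_def)
qed

end
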